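(* There exist universal positive constants $c', c_1, c_2$ such that the following holds. Let $n\in\mathbb{N}$, let $v_1,\dots,v_n$ be computation powers (non-negative, continuous almost everywhere functions $\mathbb{R}_+\to\mathbb{R}_+$) with associated functions $V_i(t)=\int_0^t v_i(\tau)\,d\tau$, and let $L,\Delta,\varepsilon>0$ and $\sigma^2\ge 0$ satisfy $\varepsilon<c' L\Delta$. Then there is a dimension $d\in\mathbb{N}$ such that for every zero-respecting algorithm $A\in\mathcal{A}_{\mathrm{zr}}$ on $\mathbb{R}^d$ there exist (a) a function $f:\mathbb{R}^d\to\mathbb{R}$ that is differentiable and $L$-smooth, i.e. $\|\nabla f(x)-\nabla f(y)\|\le L\|x-y\|$ for all $x,y\in\mathbb{R}^d$, and that admits $f^*\in\mathbb{R}$ with $f(x)\ge f^*$ for all $x\in\mathbb{R}^d$ and $f(0)-f^*\le\Delta$; and (b) stochastic gradient mappings $g_1,\dots,g_n$ (with noise distributions $\mathcal{D}_{s_x,t,i}$) for the oracles $O_1,\dots,O_n$, satisfying $\mathbb{E}_{\xi}[g_i(s_x;\xi,t)]=\nabla f(s_x)$ and $\mathbb{E}_{\xi}[\|g_i(s_x;\xi,t)-\nabla f(s_x)\|^2]\le\sigma^2$ for all $s_x\in\mathbb{R}^d$, $i\in[n]$, $t\ge0$, where $\xi\sim\mathcal{D}_{s_x,t,i}$, such that the sequences $x^k,t^k$ generated by the Time Multiple Oracles Protocol with $A$ and $O_1,\dots,O_n$ satisfy $$\mathbb{E}\Big[\inf_{k\in S_t}\|\nabla f(x^k)\|^2\Big]>\varepsilon,\qquad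 S_t:=\{k\in\mathbb{N}_0 : t^k\le t\},\qquad t=\tfrac12\,\underline{t}_{\lfloor c_1 L\Delta/\varepsilon\rfloor},$$ where $\underline{t}_0=0$ and, for all $k\ge1$, $$\underline{t}_k:=\min\Big\{t\ge0 : \sum_{i=1}^n\big\lfloor V_i(t)-V_i(\underline{t}_{k-1})\big\rfloor\ge c_2\max\big\{\lceil\sigma^2/\varepsilon\rceil,1\big\}\Big\}.$$
   Context: Notation: $\mathbb{R}_+=[0,\infty)$, $\mathbb{N}=\{1,2,\dots\}$, $\mathbb{N}_0=\{0,1,2,\dots\}$, $[n]=\{1,\dots,n\}$, $\operatorname{supp}(x)=\{i\in[d]:x_i\ne0\}$, $\|\cdot\|$ is the Euclidean norm. Convention: $\min\emptyset=\infty$, and $\underline{t}_k=\infty$ if $\underline{t}_{k-1}=\infty$. "Universal constants" are numbers independent of all other parameters. Computation powers: for each worker $i\in[n]$, $v_i:\mathbb{R}_+\to\mathbb{R}_+$ is non-negative and continuous almost everywhere, and $V_i(t)=\int_0^t v_i(\tau)d\tau$ (Riemann integral), understood to be finite, continuous and non-decreasing on $\mathbb{R}_+$; $V_i(\infty)$ is the limit. Oracles: each oracle $O_i$ has a state $(s_t,s_x,s_q)\in\mathbb{R}_+\times\mathbb{R}^d\times\{0,1\}$. It takes a time $t\in\mathbb{R}_+$, a point $x\in\mathbb{R}^d$, an input state, and a control $c\in\{0,1\}$, and returns an output state and an output vector in $\mathbb{R}^d$: $$O_i(t,x,(s_t,s_x,s_q),c)=\begin{cases}((t,x,1),\,0),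 & c=0,\ s_q=0,\\ ((s_t,s_x,1),\,0), & c=0,\ s_q=1,\ V_i(t)-V_i(s_t)<1,\\ ((0,0,0),\,g_i(s_x;\xi,t)), & c=0,\ s_q=1,\ V_i(t)-V_i(s_t)\ge1,\\ ((0,0,0),\,0), & c=1,\end{cases}$$ where $g_i:\mathbb{R}^d\times\mathbb{S}_\xi\times\mathbb{R}_+\to\mathbb{R}^d$ is a mapping and $\xi\sim\mathcal{D}_{s_x,t,i}$ is a fresh sample (drawn independently of the past at each such call) from a distribution on $\mathbb{S}_\xi$ that may depend on $s_x,t,i$. Time Multiple Oracles Protocol, for an algorithm $A=\{A^k\}_{k\ge0}$ and oracles $O_1,\dots,O_n$: set $s_i^0=(0,0,0)$ for all $i$ and $t^0=0$. For $k=0,1,2,\dots$: (1) $(t^{k+1},i^{k+1},c^{k+1},x^k)=A^k(g^1,\dots,g^k)$; (2) $(s^{k+1}_{i^{k+1}},g^{k+1})=O_{i^{k+1}}(t^{k+1},x^k,s^k_{i^{k+1}},c^{k+1})$, and $s_j^{k+1}=s_j^k$ for $j\ne i^{k+1}$. Class $\mathcal{A}_{\mathrm{zr}}$ of zero-respecting algorithms: $A=\{A^k\}_{k=0}^\infty$ such that (1) $A^0\in\mathbb{R}_+\times[n]\times\{0,1\}\times\mathbb{R}^d$ and $A^k:(\mathbb{R}^d)^k\to\mathbb{R}_+\times[n]\times\{0,1\}\times\mathbb{R}^d$ for $k\ge1$; (2) $\operatorname{supp}(x^k)\subseteq\bigcup_{j=1}^k\operatorname{supp}(g^j)$ for all $k\in\mathbb{N}_0$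 (so $x^0=0$); (3) for all $k\ge1$ and all $g^1,\dots,g^k\in\mathbb{R}^d$, $t^{k+1}\ge t^k$, where $t^{k+1}$ is the first component of $A^k(g^1,\dots,g^k)$ and $t^k$ is the first component of $A^{k-1}(g^1,\dots,g^{k-1})$. *)

theory Defs
  imports "HOL-Probability.Probability"
begin

section \<open>Euclidean space of a dimension that is quantified inside the statement\<close>

text \<open>
  The dimension is existentially quantified after other parameters, so it cannot be a type.
  A point of \<open>\<real>\<^sup>d\<close> is a function on the indices \<open>1, \<dots>, d\<close>, represented canonically by the value
  \<open>0\<close> at all other indices.
\<close>

type_synonym vec = "nat \<Rightarrow> real"

definition Rd :: "nat \<Rightarrow> vec set" where
  "Rd d = {x. \<forall>j. j \<notin> {1..d} \<longrightarrow> x j = 0}"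

definition vzero :: vec where
  "vzero = (\<lambda>_. 0)"

definition vnorm :: "nat \<Rightarrow> vec \<Rightarrow> real" where
  "vnorm d x = L2_set x {1..d}"

definition vsupp :: "nat \<Rightarrow> vec \<Rightarrow> nat set" where
  "vsupp d x = {j \<in> {1..d}. x j \<noteq> 0}"

text \<open>Frechet differentiability of \<open>f\<close> at \<open>x\<close> with gradient \<open>G\<close>:
  \<open>f (x + h) = f x + \<langle>G, h\<rangle> + o(\<parallel>h\<parallel>)\<close> as \<open>h \<rightarrow> 0\<close> in \<open>\<real>\<^sup>d\<close>.\<close>

definition has_gradient :: "nat \<Rightarrow> (vec \<Rightarrow> real) \<Rightarrow> vec \<Rightarrow> vec \<Rightarrow> bool" where
  "has_gradient d f G x \<longleftrightarrow> G \<in> Rd d \<and>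
     (\<forall>e>0. \<exists>\<delta>>0. \<forall>h\<in>Rd d. vnorm d h < \<delta> \<longrightarrow>
        \<bar>f (\<lambda>j. x j + h j) - f x - (\<Sum>j=1..d. G j * h j)\<bar> \<le> e * vnorm d h)"

lemma has_gradient_unique:
  assumes G: "has_gradient d f G x" and H: "has_gradient d f H x"
  shows "G = H"
proof (rule ccontr)
  assume ne: "G \<noteq> H"
  define u where "u = (\<lambda>j. G j - H j)"
  have mem: "G \<in> Rd d" "H \<in> Rd d" using G H by (auto simp: has_gradient_def)
  obtain j where j: "u j \<noteq> 0" using ne by (auto simp: u_def fun_eq_iff)
  have jd: "j \<in> {1..d}"
  proof (rule ccontr)
    assume "j \<notin> {1..d}"
    then have "G j = 0" "H j = 0" using mem unfolding Rd_def by blast+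
    then show False using j by (simp add: u_def)
  qed
  define N where "N = vnorm d u"
  have N2: "(\<Sum>j=1..d. u j * u j) = N * N"
    unfolding N_def vnorm_def L2_set_def
    by (simp add: sum_nonneg power2_eq_square)
  have "0 < u j * u j" using j by (metis not_real_square_gt_zero)
  also have "\<dots> \<le> (\<Sum>j=1..d. u j * u j)"
    using jd by (intro member_le_sum) auto
  finally have "0 < N * N" unfolding N2 .
  moreover have "0 \<le> N" by (simp add: N_def vnorm_def L2_set_nonneg)
  ultimately have N: "0 < N" by (cases "N = 0") auto
  have N4: "0 < N / 4" using N by simp
  from G obtain a where a: "a > 0" "\<And>h. h \<in> Rd d \<Longrightarrow> vnorm d h < a \<Longrightarrow>
      \<bar>f (\<lambda>j. x j + h j) - f x - (\<Sum>j=1..d. G j * h j)\<bar> \<le> (N / 4) * vnorm d h"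
    using N4 unfolding has_gradient_def by blast
  from H obtain b where b: "b > 0" "\<And>h. h \<in> Rd d \<Longrightarrow> vnorm d h < b \<Longrightarrow>
      \<bar>f (\<lambda>j. x j + h j) - f x - (\<Sum>j=1..d. H j * h j)\<bar> \<le> (N / 4) * vnorm d h"
    using N4 unfolding has_gradient_def by blast
  define s where "s = min a b / (2 * N)"
  have s: "0 < s" using a b N by (simp add: s_def)
  define h where "h = (\<lambda>j. s * u j)"
  have hR: "h \<in> Rd d" using mem by (auto simp: h_def u_def Rd_def)
  have hn: "vnorm d h = s * N"
    using s by (simp add: h_def vnorm_def N_def L2_set_right_distrib)
  have sN: "s * N = min a b / 2" using N by (simp add: s_def)
  have "(\<Sum>j=1..d. G j * h j) - (\<Sum>j=1..d. H j * h j) = s * (\<Sum>j=1..d. u j * u j)"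
    by (simp add: sum_subtractf[symmetric] sum_distrib_left h_def u_def algebra_simps)
  then have eq: "(\<Sum>j=1..d. G j * h j) - (\<Sum>j=1..d. H j * h j) = s * (N * N)"
    unfolding N2 .
  have lt: "vnorm d h < a" "vnorm d h < b" using a(1) b(1) unfolding hn sN by auto
  have "s * (N * N) \<le> (N / 4) * vnorm d h + (N / 4) * vnorm d h"
    using a(2)[OF hR lt(1)] b(2)[OF hR lt(2)] eq by linarith
  also have "\<dots> = s * (N * N) / 2" by (simp add: hn)
  finally show False using s N by simp
qed

section \<open>Computation powers\<close>

text \<open>Continuity and the null set are taken on \<open>[0, \<infinity>)\<close>. The integrability clause says that
  \<open>V t\<close> is finite for all \<open>t\<close>.\<close>

definition cum_power :: "(real \<Rightarrow> real) \<Rightarrow> real \<Rightarrow> real" where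
  "cum_power v t = integral {0..t} v"

definition computation_power :: "(real \<Rightarrow> real) \<Rightarrow> bool" where
  "computation_power v \<longleftrightarrow>
     (\<forall>t\<ge>0. 0 \<le> v t) \<and>
     (AE t in lborel. 0 \<le> t \<longrightarrow> continuous (at t within {0..}) v) \<and>
     (\<forall>t\<ge>0. v integrable_on {0..t})"

section \<open>Oracles and the protocol\<close>

text \<open>A state is \<open>(s_t, s_x, s_q)\<close>. The bits \<open>s_q\<close> and \<open>c\<close> are Booleans, with \<open>True\<close> for \<open>1\<close>.
  An algorithm maps the list \<open>[g_1, \<dots>, g_k]\<close> of all vectors received so far to \<open>(t, i, c, x)\<close>, so its
  restriction to lists of length \<open>k\<close> is \<open>A^k\<close>.\<close>

type_synonym ostate = "real \<times> vec \<times> bool"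
type_synonym algorithm = "vec list \<Rightarrow> real \<times> nat \<times> bool \<times> vec"

definition init_state :: ostate where
  "init_state = (0, vzero, False)"

fun oracle_call ::
  "(real \<Rightarrow> real) \<Rightarrow> (vec \<Rightarrow> 's \<Rightarrow> real \<Rightarrow> vec) \<Rightarrow> 's \<Rightarrow> real \<Rightarrow> vec \<Rightarrow> ostate \<Rightarrow> bool \<Rightarrow> ostate \<times> vec"
where
  "oracle_call V g \<xi> t x (st, sx, sq) c =
     (if c then ((0, vzero, False), vzero)
      else if \<not> sq then ((t, x, True), vzero)
      else if V t - V st < 1 then ((st, sx, True), vzero)
      else ((0, vzero, False), g sx \<xi> t))"

text \<open>The run of the protocol for a given sequence of samples: \<open>\<omega> k\<close> is the sample \<open>\<xi>\<close> available
  to the oracle call that produces the \<open>k + 1\<close>st vector. The value after \<open>k\<close> steps consists of all oracle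
  states and the list of the first \<open>k\<close> vectors; it depends only on \<open>\<omega> 0, \<dots>, \<omega> (k - 1)\<close>.\<close>

primrec protocol ::
  "algorithm \<Rightarrow> (nat \<Rightarrow> real \<Rightarrow> real) \<Rightarrow> (nat \<Rightarrow> vec \<Rightarrow> 's \<Rightarrow> real \<Rightarrow> vec) \<Rightarrow> (nat \<Rightarrow> 's)
     \<Rightarrow> nat \<Rightarrow> (nat \<Rightarrow> ostate) \<times> vec list"
where
  "protocol A V g \<omega> 0 = ((\<lambda>_. init_state), [])"
| "protocol A V g \<omega> (Suc k) =
     (let (s, gs) = protocol A V g \<omega> k;
          (t, i, c, x) = A gs;
          (s', g') = oracle_call (V i) (g i) (\<omega> k) t x (s i) c
      in (s(i := s'), gs @ [g']))"

definition proto_point where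
  "proto_point A V g \<omega> k = (let (t, i, c, x) = A (snd (protocol A V g \<omega> k)) in x)"

definition proto_time where
  "proto_time A V g \<omega> k =
     (case k of 0 \<Rightarrow> 0
      | Suc m \<Rightarrow> (let (t, i, c, x) = A (snd (protocol A V g \<omega> m)) in t))"

text \<open>Conditional law of the sample in step \<open>k\<close>, given the samples of the earlier steps. A sample is
  drawn in every step; the oracle looks at it only if it returns a stochastic gradient, so the
  other draws have no effect.\<close>

definition sample_kernel ::
  "algorithm \<Rightarrow> (nat \<Rightarrow> real \<Rightarrow> real) \<Rightarrow> (nat \<Rightarrow> vec \<Rightarrow> 's \<Rightarrow> real \<Rightarrow> vec)
     \<Rightarrow> (vec \<Rightarrow> real \<Rightarrow> nat \<Rightarrow> 's measure) \<Rightarrow> nat \<Rightarrow> (nat \<Rightarrow> 's) \<Rightarrow> 's measure"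
where
  "sample_kernel A V g D k \<omega> =
     (let (s, gs) = protocol A V g \<omega> k;
          (t, i, c, x) = A gs;
          (st, sx, sq) = s i
      in D sx t i)"

text \<open>Law of the whole sequence of samples, by the Ionescu-Tulcea theorem. It is meaningful only
  when the kernels are genuine probability kernels, which is what the locale predicate
  \<open>Ionescu_Tulcea\<close> says. Neither the algorithm nor \<open>D\<close> is measurable a priori.\<close>

definition sample_law ::
  "algorithm \<Rightarrow> (nat \<Rightarrow> real \<Rightarrow> real) \<Rightarrow> (nat \<Rightarrow> vec \<Rightarrow> 's \<Rightarrow> real \<Rightarrow> vec)
     \<Rightarrow> 's measure \<Rightarrow> (vec \<Rightarrow> real \<Rightarrow> nat \<Rightarrow> 's measure) \<Rightarrow> (nat \<Rightarrow> 's) measure"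
where
  "sample_law A V g S D =
     projective_family.lim UNIV (Ionescu_Tulcea.CI (sample_kernel A V g D) (\<lambda>_. S)) (\<lambda>_. S)"

section \<open>Algorithms, functions and stochastic gradients\<close>

definition zero_respecting :: "nat \<Rightarrow> nat \<Rightarrow> algorithm \<Rightarrow> bool" where
  "zero_respecting d n A \<longleftrightarrow>
     (\<forall>gs \<in> lists (Rd d). let (t, i, c, x) = A gs in
        0 \<le> t \<and> i \<in> {1..n} \<and> x \<in> Rd d \<and>
        vsupp d x \<subseteq> (\<Union>g\<in>set gs. vsupp d g) \<and>
        (gs \<noteq> [] \<longrightarrow> fst (A (butlast gs)) \<le> t))"

text \<open>\<open>f'\<close> is the gradient of \<open>f\<close>.\<close>

definition smooth_fun :: "nat \<Rightarrow> real \<Rightarrow> (vec \<Rightarrow> real) \<Rightarrow> (vec \<Rightarrow> vec) \<Rightarrow> bool" where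
  "smooth_fun d L f f' \<longleftrightarrow>
     (\<forall>x\<in>Rd d. has_gradient d f (f' x) x) \<and>
     (\<forall>x\<in>Rd d. \<forall>y\<in>Rd d.
        vnorm d (\<lambda>j. f' x j - f' y j) \<le> L * vnorm d (\<lambda>j. x j - y j))"

text \<open>The expectation of a random vector is taken coordinatewise. The integrability clauses exclude
  the default value \<open>0\<close> of the Bochner integral.\<close>

definition stochastic_gradients ::
  "nat \<Rightarrow> nat \<Rightarrow> (vec \<Rightarrow> vec) \<Rightarrow> real \<Rightarrow> 's measure \<Rightarrow> (vec \<Rightarrow> real \<Rightarrow> nat \<Rightarrow> 's measure)
     \<Rightarrow> (nat \<Rightarrow> vec \<Rightarrow> 's \<Rightarrow> real \<Rightarrow> vec) \<Rightarrow> bool"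
where
  "stochastic_gradients d n f' \<sigma>sq S D g \<longleftrightarrow>
     (\<forall>x\<in>Rd d. \<forall>i\<in>{1..n}. \<forall>t\<ge>0.
        prob_space (D x t i) \<and> sets (D x t i) = sets S \<and>
        (\<forall>\<xi>\<in>space S. g i x \<xi> t \<in> Rd d) \<and>
        (\<forall>j\<in>{1..d}. integrable (D x t i) (\<lambda>\<xi>. g i x \<xi> t j) \<and>
           (\<integral>\<xi>. g i x \<xi> t j \<partial>D x t i) = f' x j) \<and>
        integrable (D x t i) (\<lambda>\<xi>. (vnorm d (\<lambda>j. g i x \<xi> t j - f' x j))\<^sup>2) \<and>
        (\<integral>\<xi>. (vnorm d (\<lambda>j. g i x \<xi> t j - f' x j))\<^sup>2 \<partial>D x t i) \<le> \<sigma>sq)"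

section \<open>The sequence of lower time bounds\<close>

text \<open>\<open>min_time P\<close> is the minimum of \<open>{t \<ge> 0. P t}\<close>, which is \<open>\<infinity>\<close> for the empty set.
  In \<open>lower_time\<close> the minimum exists for a nonempty set because \<open>V\<close> is continuous and nondecreasing.\<close>

definition min_time :: "(real \<Rightarrow> bool) \<Rightarrow> ereal" where
  "min_time P = (if \<exists>t\<ge>0. P t then ereal (LEAST t. 0 \<le> t \<and> P t) else \<infinity>)"

primrec lower_time :: "nat \<Rightarrow> (nat \<Rightarrow> real \<Rightarrow> real) \<Rightarrow> real \<Rightarrow> nat \<Rightarrow> ereal" where
  "lower_time n V m 0 = 0"
| "lower_time n V m (Suc k) =
     (if lower_time n V m k = \<infinity> then \<infinity>
      else min_time (\<lambda>t. real_of_int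
             (\<Sum>i=1..n. \<lfloor>V i t - V i (real_of_ereal (lower_time n V m k))\<rfloor>) \<ge> m))"

end

theory Submission
  imports Defs
begin

text \<open>
  The hard function is a chain: a scaled sum of terms that couple consecutive coordinates, built so
  that (i) at a point whose last nonzero coordinate is \<open>r\<close> the gradient vanishes beyond \<open>r + 1\<close>, and
  (ii) as long as the last coordinate \<open>T\<close> of a point is zero, its gradient is large. A zero-respecting
  algorithm must therefore reveal the coordinates one at a time, in order, and only a point that uses
  coordinate \<open>r\<close> can reveal coordinate \<open>r + 1\<close>. The whole chain costs an initial gap proportional to
  \<open>T\<close>, which allows \<open>T\<close> of order \<open>L \<Delta> / \<epsilon>\<close>.

  The oracle spends its variance on the one coordinate that would be new: it multiplies that
  coordinate by \<open>\<xi> / p\<close>, where \<open>\<xi>\<close> is one with probability \<open>p\<close> and zero otherwise. Variance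
  \<open>\<sigma>\<^sup>2\<close> permits \<open>p\<close> of order \<open>\<epsilon> / (\<sigma>\<^sup>2 + \<epsilon>)\<close>, so a new coordinate typically takes of order
  \<open>\<sigma>\<^sup>2 / \<epsilon> + 1\<close> useful gradients, where a gradient is useful if it was computed at a point that involves
  the coordinate revealed last.

  Two arguments bound the time. First, a useful gradient must have been started after the last
  reveal, at time \<open>\<tau>\<close> say, so that worker \<open>i\<close> contributes at most \<open>\<lfloor>V\<^sub>i(t) - V\<^sub>i(\<tau>)\<rfloor>\<close> of them by
  time \<open>t\<close>. A reveal that takes at least \<open>M\<close> useful gradients, where \<open>M\<close> is the rounded threshold in the
  recursion for the lower times, therefore advances this recursion by one step (\<open>run_ok\<close>).
  Second, few reveals are lucky, that is, faster than that: in each stage at most \<open>M - 1\<close> gradients can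
  lead to a lucky reveal, and each does so with conditional probability \<open>p\<close>, so that the expected
  number of lucky reveals is at most \<open>p (M - 1) (T + 1)\<close>, which is at most a quarter of \<open>T + 1\<close>
  (\<open>coins_success_count\<close>). By Markov's inequality, with probability at least one half fewer than
  about half of the coordinates are reached by luck, and then the others force the time beyond the required
  lower time before the chain is completed (\<open>expected_gradient_ge\<close>). Only the total count of lucky
  reveals enters, so a first moment suffices, and it covers all steps of the protocol at once.

  The samples have the same law whatever the query is, so the Ionescu-Tulcea law is an infinite
  product of coins. Everything that happens up to step \<open>k\<close> depends on \<open>k\<close> coins, that is, on a finite
  space, and this makes it measurable for an arbitrary algorithm.
\<close>

section \<open>The chain function\<close>

text \<open>
  The derivative of \<open>half_sq\<close> is the positive part, so linear combinations of its shifts have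
  piecewise linear, hence Lipschitz, derivatives. All one-dimensional ingredients of the chain are of
  this kind.
\<close>

definition half_sq :: "real \<Rightarrow> real" where
  "half_sq x = (max 0 x)\<^sup>2 / 2"

lemma half_sq_remainder: "\<bar>half_sq (a + u) - half_sq a - max 0 a * u\<bar> \<le> u\<^sup>2 / 2"
proof -
  consider "a \<ge> 0" "a + u \<ge> 0" | "a \<ge> 0" "a + u < 0" | "a < 0" "a + u \<ge> 0" | "a < 0" "a + u < 0"
    by linarith
  then show ?thesis
  proof cases
    case 1
    then have "half_sq (a + u) - half_sq a - max 0 a * u = u\<^sup>2 / 2"
      by (simp add: half_sq_def max_def power2_eq_square field_simps)
    then show ?thesis by (simp only: abs_of_nonneg zero_le_power2 divide_nonneg_pos order_refl zero_less_numeral)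
  next
    case 2
    then have eq: "half_sq (a + u) - half_sq a - max 0 a * u = (u\<^sup>2 - (a + u)\<^sup>2) / 2"
      by (simp add: half_sq_def max_def power2_eq_square field_simps)
    have "(a + u)\<^sup>2 \<le> u\<^sup>2"
      using 2 by (intro abs_le_square_iff[THEN iffD1]) auto
    then show ?thesis unfolding eq by simp
  next
    case 3
    then have eq: "half_sq (a + u) - half_sq a - max 0 a * u = (a + u)\<^sup>2 / 2"
      by (simp add: half_sq_def max_def)
    have "(a + u)\<^sup>2 \<le> u\<^sup>2"
      using 3 by (intro abs_le_square_iff[THEN iffD1]) auto
    then show ?thesis unfolding eq by simp
  next
    case 4
    then show ?thesis by (simp add: half_sq_def)
  qed
qed

lemma half_sq_has_derivative: "(half_sq has_real_derivative max 0 a) (at a)"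
proof -
  have "(\<lambda>h. (half_sq (a + h) - half_sq a) / h) \<midarrow>0\<rightarrow> max 0 a"
  proof (rule LIM_zero_cancel, rule Lim_transform_bound)
    show "((\<lambda>h. h) \<longlongrightarrow> 0) (at (0::real))"
      by (rule tendsto_ident_at)
  next
    show "\<forall>\<^sub>F h in at 0. norm ((half_sq (a + h) - half_sq a) / h - max 0 a) \<le> norm h"
    proof -
      have "\<bar>(half_sq (a + h) - half_sq a) / h - max 0 a\<bar> \<le> \<bar>h\<bar>" if h: "h \<noteq> 0" for h
      proof -
        have "\<bar>(half_sq (a + h) - half_sq a) / h - max 0 a\<bar> = \<bar>half_sq (a + h) - half_sq a - max 0 a * h\<bar> / \<bar>h\<bar>"
          using h by (simp add: field_simps flip: abs_divide)
        also have "\<dots> \<le> (h\<^sup>2 / 2) / \<bar>h\<bar>"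
          by (intro divide_right_mono half_sq_remainder) simp
        also have "\<dots> = \<bar>h\<bar> / 2"
          using h by (subst power2_abs[symmetric]) (simp add: power2_eq_square del: power2_abs abs_mult_self_eq)
        also have "\<dots> \<le> \<bar>h\<bar>" by simp
        finally show ?thesis .
      qed
      then show ?thesis by (auto simp: eventually_at intro!: exI[of _ 1])
    qed
  qed
  then show ?thesis by (simp add: DERIV_def)
qed

text \<open>
  A monotone step from \<open>0\<close>, for arguments up to \<open>0\<close>, to \<open>1\<close>, for arguments from \<open>2\<close> on.
\<close>

definition ramp :: "real \<Rightarrow> real" where
  "ramp x = half_sq x - 2 * half_sq (x - 1) + half_sq (x - 2)"

definition tent :: "real \<Rightarrow> real" where
  "tent x = max 0 x - 2 * max 0 (x - 1) + max 0 (x - 2)"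

text \<open>
  A one-sided Huber function: it grows linearly for very negative arguments. Its slope keeps the
  gradient of the chain large there, where the ramp is flat.
\<close>

definition penalty :: "real \<Rightarrow> real" where
  "penalty x = half_sq (- x) - half_sq (- x - 1)"

definition penalty' :: "real \<Rightarrow> real" where
  "penalty' x = max 0 (- x - 1) - max 0 (- x)"

lemma ramp_has_derivative: "(ramp has_real_derivative tent x) (at x)"
  unfolding ramp_def[abs_def] tent_def
  by (auto intro!: derivative_eq_intros half_sq_has_derivative[THEN DERIV_chain2])

lemma tent_bounds: "0 \<le> tent x" "tent x \<le> 1"
  by (auto simp: tent_def max_def)

lemma tent_lipschitz: "\<bar>tent x - tent y\<bar> \<le> \<bar>x - y\<bar>"
  by (auto simp: tent_def max_def)

lemma ramp_mono: "x \<le> y \<Longrightarrow> ramp x \<le> ramp y"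
  by (rule DERIV_nonneg_imp_nondecreasing[of x y ramp]) (auto intro: ramp_has_derivative tent_bounds)

lemma ramp_le_zero: "x \<le> 0 \<Longrightarrow> ramp x = 0"
  by (simp add: ramp_def half_sq_def)

lemma ramp_ge_two: "x \<ge> 2 \<Longrightarrow> ramp x = 1"
  by (simp add: ramp_def half_sq_def max_def power2_eq_square field_simps)

lemma ramp_bounds: "0 \<le> ramp x" "ramp x \<le> 1"
  using ramp_mono[of "min 0 x" x] ramp_mono[of x "max 2 x"]
  by (simp_all add: ramp_le_zero ramp_ge_two)

lemma ramp_lipschitz: "\<bar>ramp x - ramp y\<bar> \<le> \<bar>x - y\<bar>"
  using field_differentiable_bound[of UNIV ramp tent 1 y x] tent_bounds ramp_has_derivative
  by (auto simp: abs_le_iff intro: order_trans[of _ 0])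

lemma ramp_remainder: "\<bar>ramp (a + u) - ramp a - tent a * u\<bar> \<le> 2 * u\<^sup>2"
proof -
  define r where "r c = half_sq (c + u) - half_sq c - max 0 c * u" for c
  have r: "\<bar>r c\<bar> \<le> u\<^sup>2 / 2" for c
    unfolding r_def by (rule half_sq_remainder)
  have "a + u - 1 = (a - 1) + u" "a + u - 2 = (a - 2) + u" by auto
  then have "ramp (a + u) - ramp a - tent a * u = r a - 2 * r (a - 1) + r (a - 2)"
    by (simp only: ramp_def tent_def r_def left_diff_distrib distrib_right) simp
  then show ?thesis
    using r[of a] r[of "a - 1"] r[of "a - 2"] by (simp only: abs_le_iff) linarith
qed

lemma penalty_remainder: "\<bar>penalty (a + u) - penalty a - penalty' a * u\<bar> \<le> u\<^sup>2"
proof -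
  let ?r = "half_sq (- a + - u) - half_sq (- a) - max 0 (- a) * - u"
  let ?s = "half_sq ((- a - 1) + - u) - half_sq (- a - 1) - max 0 (- a - 1) * - u"
  have "- (a + u) = - a + - u" "- a + - u - 1 = (- a - 1) + - u" by auto
  then have "penalty (a + u) - penalty a - penalty' a * u = ?r - ?s"
    by (simp only: penalty_def penalty'_def left_diff_distrib mult_minus_right)
  moreover have "\<bar>?r\<bar> \<le> u\<^sup>2 / 2" "\<bar>?s\<bar> \<le> u\<^sup>2 / 2"
    using half_sq_remainder[of _ "- u"] unfolding power2_minus by blast+
  ultimately show ?thesis by (simp only: abs_le_iff) linarith
qed

lemma penalty'_lipschitz: "\<bar>penalty' x - penalty' y\<bar> \<le> \<bar>x - y\<bar>"
  by (auto simp: penalty'_def max_def)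

lemma penalty_nonneg: "0 \<le> penalty x"
  unfolding penalty_def half_sq_def by (auto simp: max_def power2_eq_square field_simps mult_nonneg_nonneg)

text \<open>
  The product term rewards a large successor \<open>b\<close> only if its predecessor \<open>a\<close> is positive. The
  second factor is shifted by one so that its slope is maximal at \<open>b = 0\<close>, while the first factor has
  slope zero at \<open>a = 0\<close>: a zero coordinate is pulled by its predecessor but does not pull its
  successor.
\<close>

definition link :: "real \<Rightarrow> real \<Rightarrow> real" where
  "link a b = penalty b - ramp a * ramp (b + 1)"

definition link1 :: "real \<Rightarrow> real \<Rightarrow> real" where
  "link1 a b = - (tent a * ramp (b + 1))"

definition link2 :: "real \<Rightarrow> real \<Rightarrow> real" where
  "link2 a b = penalty' b - ramp a * tent (b + 1)"

lemma link_remainder: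
  "\<bar>link (a + u) (b + v) - link a b - link1 a b * u - link2 a b * v\<bar> \<le> 4 * (u\<^sup>2 + v\<^sup>2)"
proof -
  let ?ru = "ramp (a + u) - ramp a - tent a * u"
  let ?rv = "ramp (b + 1 + v) - ramp (b + 1) - tent (b + 1) * v"
  let ?rp = "penalty (b + v) - penalty b - penalty' b * v"
  let ?d = "ramp (b + 1 + v) - ramp (b + 1)"
  have eq: "link (a + u) (b + v) - link a b - link1 a b * u - link2 a b * v =
      ?rp - ?ru * ramp (b + 1 + v) - ramp a * ?rv - tent a * (u * ?d)"
    by (simp add: link_def link1_def link2_def algebra_simps)
  have "\<bar>?ru * ramp (b + 1 + v)\<bar> \<le> (2 * u\<^sup>2) * 1"
    unfolding abs_mult using ramp_bounds by (intro mult_mono ramp_remainder) auto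
  moreover have "\<bar>ramp a * ?rv\<bar> \<le> 1 * (2 * v\<^sup>2)"
    unfolding abs_mult using ramp_bounds ramp_remainder by (intro mult_mono) auto
  moreover have "\<bar>tent a * (u * ?d)\<bar> \<le> 1 * (\<bar>u\<bar> * \<bar>v\<bar>)"
    unfolding abs_mult using tent_bounds ramp_lipschitz[of "b + 1 + v" "b + 1"]
    by (intro mult_mono) auto
  moreover have "\<bar>u\<bar> * \<bar>v\<bar> \<le> (u\<^sup>2 + v\<^sup>2) / 2"
    using sum_squares_bound[of "\<bar>u\<bar>" "\<bar>v\<bar>"] by simp
  moreover have "0 \<le> u\<^sup>2" "0 \<le> v\<^sup>2" by auto
  moreover have "\<bar>p - q - r - s\<bar> \<le> 4 * (U + V)"
    if "\<bar>p\<bar> \<le> V" "\<bar>q\<bar> \<le> 2 * U * 1" "\<bar>r\<bar> \<le> 1 * (2 * V)" "\<bar>s\<bar> \<le> 1 * w"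
      "w \<le> (U + V) / 2" "0 \<le> U" "0 \<le> V" for p q r s U V w :: real
  proof -
    have "\<bar>p - q - r - s\<bar> \<le> \<bar>p\<bar> + \<bar>q\<bar> + \<bar>r\<bar> + \<bar>s\<bar>" by linarith
    also have "\<dots> \<le> V + 2 * U + 2 * V + (U + V) / 2"
      using that by (intro add_mono) auto
    also have "\<dots> \<le> 4 * (U + V)" using that by (simp add: field_simps)
    finally show ?thesis .
  qed
  ultimately show ?thesis
    unfolding eq using penalty_remainder[of b v] by blast
qed

lemma mult_lipschitz:
  fixes p q p' q' :: real
  assumes "\<bar>p\<bar> \<le> 1" "\<bar>q'\<bar> \<le> 1" "\<bar>p - p'\<bar> \<le> u" "\<bar>q - q'\<bar> \<le> v"
  shows "\<bar>p * q - p' * q'\<bar> \<le> u + v"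
proof -
  have "p * q - p' * q' = (p - p') * q' + p * (q - q')" by (simp add: algebra_simps)
  moreover have "\<bar>(p - p') * q'\<bar> \<le> u * 1"
    unfolding abs_mult using assms by (intro mult_mono) auto
  moreover have "\<bar>p * (q - q')\<bar> \<le> 1 * v"
    unfolding abs_mult using assms by (intro mult_mono) auto
  ultimately show ?thesis by linarith
qed

lemma link1_lipschitz: "\<bar>link1 a b - link1 a' b'\<bar> \<le> \<bar>a - a'\<bar> + \<bar>b - b'\<bar>"
  using mult_lipschitz[of "tent a" "ramp (b' + 1)" "tent a'" _ "ramp (b + 1)", OF _ _ tent_lipschitz ramp_lipschitz]
    tent_bounds[of a] ramp_bounds[of "b' + 1"]
  by (simp add: link1_def abs_le_iff)

lemma link2_lipschitz: "\<bar>link2 a b - link2 a' b'\<bar> \<le> \<bar>a - a'\<bar> + 2 * \<bar>b - b'\<bar>"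
  using mult_lipschitz[of "ramp a" "tent (b' + 1)" "ramp a'" _ "tent (b + 1)", OF _ _ ramp_lipschitz tent_lipschitz]
    ramp_bounds[of a] tent_bounds[of "b' + 1"] penalty'_lipschitz[of b b']
  by (simp add: link2_def abs_le_iff)

lemma link1_nonpos: "link1 a b \<le> 0"
  using tent_bounds ramp_bounds by (simp add: link1_def)

text \<open>
  For moderate \<open>b\<close> the product term has a steep slope; for \<open>b\<close> below \<open>- 1/2\<close> the penalty takes
  over.
\<close>

lemma link2_le:
  assumes "a \<ge> 1/2" "b < 1/2"
  shows "link2 a b \<le> - 1/16"
proof (cases "b \<ge> - 1/2")
  case True
  have "1/8 = ramp (1/2)" by (simp add: ramp_def half_sq_def power2_eq_square)
  also have "\<dots> \<le> ramp a" using assms by (intro ramp_mono)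
  finally have "1/8 * (1/2) \<le> ramp a * tent (b + 1)"
    using True assms by (intro mult_mono) (auto simp: tent_def max_def)
  then show ?thesis by (simp add: link2_def penalty'_def max_def)
next
  case False
  then have "penalty' b \<le> - 1/2" by (simp add: penalty'_def max_def)
  moreover have "0 \<le> ramp a * tent (b + 1)" using ramp_bounds tent_bounds by simp
  ultimately show ?thesis by (simp add: link2_def)
qed

text \<open>
  The chain starts at a virtual coordinate \<open>0\<close> with value \<open>2\<close>, where the ramp has reached \<open>1\<close>;
  thus the first real coordinate is always pulled.
\<close>

definition pad :: "vec \<Rightarrow> vec" where
  "pad x = x(0 := 2)"

definition chain :: "nat \<Rightarrow> vec \<Rightarrow> real" where
  "chain T x = (\<Sum>i<T. link (pad x i) (x (Suc i)))"

definition chain_grad :: "nat \<Rightarrow> vec \<Rightarrow> vec" where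
  "chain_grad T x j =
     (if j \<in> {1..T} then link2 (pad x (j - 1)) (x j) + (if j < T then link1 (x j) (x (Suc j)) else 0) else 0)"

lemma vnorm_sq: "(vnorm d x)\<^sup>2 = (\<Sum>j=1..d. (x j)\<^sup>2)"
  by (simp add: vnorm_def L2_set_def sum_nonneg)

lemma vnorm_nonneg: "0 \<le> vnorm d x"
  by (simp add: vnorm_def L2_set_nonneg)

lemma vnorm_mult: "vnorm d (\<lambda>j. c * x j) = \<bar>c\<bar> * vnorm d x"
  by (rule power2_eq_imp_eq)
    (simp_all add: vnorm_nonneg vnorm_sq power_mult_distrib sum_distrib_left)

lemma sum_lessThan_Suc_eq: "(\<Sum>i<T. f (Suc i)) = (\<Sum>j=1..T. f j)"
  by (simp add: sum.atLeast1_atMost_eq)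

lemma sum_shift_zero:
  fixes f :: "nat \<Rightarrow> 'a :: comm_monoid_add"
  assumes "f 0 = 0"
  shows "(\<Sum>i<T. f i) = (\<Sum>j=1..T. if j < T then f j else 0)"
proof (cases T)
  case (Suc k)
  have "(\<Sum>i<T. f i) = (\<Sum>i<k. f (Suc i))"
    unfolding Suc sum.lessThan_Suc_shift using assms by simp
  also have "\<dots> = (\<Sum>j=1..k. f j)" by (rule sum_lessThan_Suc_eq)
  also have "\<dots> = (\<Sum>j=1..T. if j < T then f j else 0)"
    unfolding Suc by (auto intro!: sum.cong)
  finally show ?thesis .
qed simp

lemma sum_shift_le:
  fixes f :: "nat \<Rightarrow> real"
  assumes "f 0 = 0" "\<And>j. 0 \<le> f j"
  shows "(\<Sum>i<T. f i) \<le> (\<Sum>j=1..T. f j)"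
  unfolding sum_shift_zero[of f, OF assms(1)] using assms by (intro sum_mono) auto

lemma chain_has_gradient:
  shows "has_gradient T (chain T) (chain_grad T x) x"
  unfolding has_gradient_def
proof (intro conjI allI impI)
  show "chain_grad T x \<in> Rd T" by (auto simp: Rd_def chain_grad_def)
next
  fix e :: real assume e: "e > 0"
  show "\<exists>\<delta>>0. \<forall>h\<in>Rd T. vnorm T h < \<delta> \<longrightarrow>
      \<bar>chain T (\<lambda>j. x j + h j) - chain T x - (\<Sum>j=1..T. chain_grad T x j * h j)\<bar> \<le> e * vnorm T h"
  proof (intro exI[of _ "e / 8"] conjI ballI impI)
    fix h assume h: "h \<in> Rd T" and small: "vnorm T h < e / 8"
    have h0: "h 0 = 0" using h by (auto simp: Rd_def)
    have pad: "pad (\<lambda>j. x j + h j) i = pad x i + h i" for i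
      using h0 by (simp add: pad_def)
    have 1: "(\<Sum>i<T. link2 (pad x i) (x (Suc i)) * h (Suc i)) =
        (\<Sum>j=1..T. link2 (pad x (j - 1)) (x j) * h j)"
      using sum_lessThan_Suc_eq[of "\<lambda>j. link2 (pad x (j - 1)) (x j) * h j" T] by simp
    have 2: "(\<Sum>i<T. link1 (pad x i) (x (Suc i)) * h i) =
        (\<Sum>j=1..T. if j < T then link1 (x j) (x (Suc j)) * h j else 0)"
      by (subst sum_shift_zero) (auto simp: h0 pad_def intro!: sum.cong)
    have "(\<Sum>j=1..T. chain_grad T x j * h j) =
        (\<Sum>i<T. link1 (pad x i) (x (Suc i)) * h i + link2 (pad x i) (x (Suc i)) * h (Suc i))"
      unfolding sum.distrib 1 2
      by (simp add: sum.distrib[symmetric] chain_grad_def algebra_simps cong: sum.cong)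
        (auto intro!: sum.cong simp: algebra_simps)
    then have "\<bar>chain T (\<lambda>j. x j + h j) - chain T x - (\<Sum>j=1..T. chain_grad T x j * h j)\<bar> =
        \<bar>\<Sum>i<T. link (pad x i + h i) (x (Suc i) + h (Suc i)) - link (pad x i) (x (Suc i))
           - link1 (pad x i) (x (Suc i)) * h i - link2 (pad x i) (x (Suc i)) * h (Suc i)\<bar>"
      by (simp add: chain_def pad sum_subtractf sum.distrib)
    also have "\<dots> \<le> (\<Sum>i<T. 4 * ((h i)\<^sup>2 + (h (Suc i))\<^sup>2))"
      by (intro sum_abs[THEN order_trans] sum_mono link_remainder)
    also have "\<dots> = 4 * ((\<Sum>i<T. (h i)\<^sup>2) + (\<Sum>j=1..T. (h j)\<^sup>2))"
      using sum_lessThan_Suc_eq[of "\<lambda>j. (h j)\<^sup>2" T] by (simp add: sum_distrib_left[symmetric] sum.distrib)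
    also have "\<dots> \<le> 8 * (vnorm T h)\<^sup>2"
      unfolding vnorm_sq using sum_shift_le[of "\<lambda>j. (h j)\<^sup>2" T] h0 by simp
    also have "\<dots> \<le> e * vnorm T h"
      using small vnorm_nonneg[of T h] mult_right_mono[of "8 * vnorm T h" e "vnorm T h"]
      by (simp add: power2_eq_square)
    finally show "\<bar>chain T (\<lambda>j. x j + h j) - chain T x - (\<Sum>j=1..T. chain_grad T x j * h j)\<bar> \<le> e * vnorm T h" .
  qed (use e in simp)
qed

text \<open>
  A partial derivative depends on three neighbouring coordinates, with Lipschitz constants
  \<open>1, 3, 1\<close>. The Cauchy-Schwarz inequality bounds its squared change by \<open>11\<close> times the sum of three
  squared changes, and each coordinate occurs in at most three such sums; finally \<open>33 \<le> 6\<^sup>2\<close>.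
\<close>

lemma chain_grad_lipschitz:
  assumes "x \<in> Rd T" "y \<in> Rd T"
  shows "vnorm T (\<lambda>j. chain_grad T x j - chain_grad T y j) \<le> 6 * vnorm T (\<lambda>j. x j - y j)"
proof (rule power2_le_imp_le)
  define u where "u j = \<bar>x j - y j\<bar>" for j
  have u0: "u 0 = 0" using assms by (auto simp: Rd_def u_def)
  have uT: "u (Suc T) = 0" using assms by (auto simp: Rd_def u_def)
  have cs: "(p + 3 * q + r)\<^sup>2 \<le> 11 * (p\<^sup>2 + q\<^sup>2 + r\<^sup>2)" for p q r :: real
  proof -
    \<comment> \<open>Lagrange's identity for the vectors \<open>(1, 3, 1)\<close> and \<open>(p, q, r)\<close>.\<close>
    have "11 * (p\<^sup>2 + q\<^sup>2 + r\<^sup>2) - (p + 3 * q + r)\<^sup>2 = (3 * p - q)\<^sup>2 + (p - r)\<^sup>2 + (q - 3 * r)\<^sup>2"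
      by (simp add: power2_eq_square algebra_simps)
    moreover have "\<dots> \<ge> 0" by simp
    ultimately show ?thesis by linarith
  qed
  have pt: "(chain_grad T x j - chain_grad T y j)\<^sup>2 \<le> 11 * ((u (j - 1))\<^sup>2 + (u j)\<^sup>2 + (u (Suc j))\<^sup>2)"
    if j: "j \<in> {1..T}" for j
  proof -
    have pad: "\<bar>pad x (j - 1) - pad y (j - 1)\<bar> \<le> u (j - 1)" by (simp add: pad_def u_def)
    have l2: "\<bar>link2 (pad x (j - 1)) (x j) - link2 (pad y (j - 1)) (y j)\<bar> \<le> u (j - 1) + 2 * u j"
      using link2_lipschitz[of "pad x (j - 1)" "x j" "pad y (j - 1)" "y j"] pad unfolding u_def by linarith
    have l1: "\<bar>link1 (x j) (x (Suc j)) - link1 (y j) (y (Suc j))\<bar> \<le> u j + u (Suc j)"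
      unfolding u_def by (rule link1_lipschitz)
    have "chain_grad T x j - chain_grad T y j =
        (link2 (pad x (j - 1)) (x j) - link2 (pad y (j - 1)) (y j)) +
        (if j < T then link1 (x j) (x (Suc j)) - link1 (y j) (y (Suc j)) else 0)"
      using j by (simp add: chain_grad_def)
    also have "\<bar>\<dots>\<bar> \<le> (u (j - 1) + 2 * u j) + (u j + u (Suc j))"
      using l1 l2 by (intro abs_triangle_ineq[THEN order_trans] add_mono) (auto simp: u_def)
    finally have "\<bar>chain_grad T x j - chain_grad T y j\<bar> \<le> u (j - 1) + 3 * u j + u (Suc j)"
      by simp
    then have "\<bar>chain_grad T x j - chain_grad T y j\<bar>\<^sup>2 \<le> (u (j - 1) + 3 * u j + u (Suc j))\<^sup>2"
      by (intro power_mono) auto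
    then have "(chain_grad T x j - chain_grad T y j)\<^sup>2 \<le> (u (j - 1) + 3 * u j + u (Suc j))\<^sup>2"
      by (simp only: power2_abs)
    then show ?thesis using cs by (rule order_trans)
  qed
  have below: "(\<Sum>j=1..T. (u (j - 1))\<^sup>2) \<le> (\<Sum>j=1..T. (u j)\<^sup>2)"
    using sum_lessThan_Suc_eq[of "\<lambda>j. (u (j - 1))\<^sup>2" T] sum_shift_le[of "\<lambda>j. (u j)\<^sup>2" T] u0 by simp
  have above: "(\<Sum>j=1..T. (u (Suc j))\<^sup>2) \<le> (\<Sum>j=1..T. (u j)\<^sup>2)"
  proof -
    have "(\<Sum>j=1..T. (u (Suc j))\<^sup>2) = (\<Sum>j\<in>Suc ` {1..T}. (u j)\<^sup>2)"
      by (subst sum.reindex) simp_all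
    also have "\<dots> \<le> (\<Sum>j=1..Suc T. (u j)\<^sup>2)"
      by (intro sum_mono2) auto
    finally show ?thesis using uT by simp
  qed
  have "(vnorm T (\<lambda>j. chain_grad T x j - chain_grad T y j))\<^sup>2 \<le>
      (\<Sum>j=1..T. 11 * ((u (j - 1))\<^sup>2 + (u j)\<^sup>2 + (u (Suc j))\<^sup>2))"
    unfolding vnorm_sq by (intro sum_mono pt)
  also have "\<dots> \<le> 33 * (\<Sum>j=1..T. (u j)\<^sup>2)"
    unfolding sum_distrib_left[symmetric] sum.distrib using below above by simp
  also have "\<dots> \<le> (6 * vnorm T (\<lambda>j. x j - y j))\<^sup>2"
    unfolding power_mult_distrib vnorm_sq by (simp add: u_def sum_nonneg)
  finally show "(vnorm T (\<lambda>j. chain_grad T x j - chain_grad T y j))\<^sup>2 \<le> (6 * vnorm T (\<lambda>j. x j - y j))\<^sup>2" .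
qed (simp add: vnorm_nonneg)

lemma chain_ge: "- real T \<le> chain T x"
proof -
  have "- 1 \<le> link a b" for a b
    using penalty_nonneg[of b] mult_mono[of "ramp a" 1 "ramp (b + 1)" 1] ramp_bounds by (simp add: link_def)
  then have "(\<Sum>i<T. - 1) \<le> chain T x" unfolding chain_def by (intro sum_mono)
  then show ?thesis by simp
qed

lemma chain_vzero_le: "chain T vzero \<le> 0"
proof -
  have "link a 0 \<le> 0" for a
    using ramp_bounds by (simp add: link_def penalty_def half_sq_def)
  then show ?thesis unfolding chain_def vzero_def by (intro sum_nonpos) simp
qed

text \<open>
  The zero-chain property: a coordinate receives no gradient if it, its predecessor and all its
  successors are zero.
\<close>

lemma chain_grad_zero:
  assumes "\<forall>i\<ge>j. x i = 0" "j \<ge> 2" "x (j - 1) = 0"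
  shows "chain_grad T x j = 0"
  using assms by (auto simp: chain_grad_def link1_def link2_def pad_def tent_def penalty'_def ramp_le_zero)

lemma chain_grad_hidden:
  assumes "\<forall>i\<ge>j. x i = 0"
  shows "\<bar>chain_grad T x j\<bar> \<le> 1"
proof -
  have "x j = 0" "x (Suc j) = 0" using assms by auto
  then have "chain_grad T x j = 0 \<or> chain_grad T x j = - ramp (pad x (j - 1))"
    by (auto simp: chain_grad_def link1_def link2_def tent_def penalty'_def)
  then show ?thesis using ramp_bounds[of "pad x (j - 1)"] by auto
qed

text \<open>
  Along the chain from the virtual coordinate with value \<open>2\<close> to \<open>x T = 0\<close> there is a first
  coordinate below \<open>1/2\<close>. Its predecessor pulls it, and the derivative of the link to its successor has
  the same sign, so the two contributions cannot cancel.
\<close>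

lemma chain_grad_large:
  assumes T: "T \<ge> 1" and last: "x T = 0"
  shows "(1/16)\<^sup>2 \<le> (vnorm T (chain_grad T x))\<^sup>2"
proof -
  define j where "j = (LEAST j. pad x j < 1/2)"
  have "pad x T < 1/2" using T last by (simp add: pad_def)
  then have j: "pad x j < 1/2" "j \<le> T" and least: "\<And>i. i < j \<Longrightarrow> \<not> pad x i < 1/2"
    unfolding j_def by (auto intro: LeastI Least_le dest: not_less_Least)
  have "j \<noteq> 0" using j(1) by (auto simp: pad_def intro: ccontr)
  then have xj: "x j < 1/2" and j1: "j \<in> {1..T}" and prev: "pad x (j - 1) \<ge> 1/2"
    using j least[of "j - 1"] by (auto simp: pad_def)
  have "chain_grad T x j \<le> - 1/16"
    using link2_le[OF prev xj] link1_nonpos[of "x j" "x (Suc j)"] j1 by (simp add: chain_grad_def)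
  then have "(1/16)\<^sup>2 \<le> (chain_grad T x j)\<^sup>2"
    by (intro abs_le_square_iff[THEN iffD1]) auto
  also have "\<dots> \<le> (vnorm T (chain_grad T x))\<^sup>2"
    unfolding vnorm_sq using j1 by (intro member_le_sum) auto
  finally show ?thesis .
qed

section \<open>The lower times\<close>

lemma cum_power_mono:
  assumes "computation_power v"
  shows "mono_on {0..} (cum_power v)"
proof (rule mono_onI)
  fix r s :: real assume rs: "r \<in> {0..}" "s \<in> {0..}" "r \<le> s"
  show "cum_power v r \<le> cum_power v s"
    unfolding cum_power_def using assms rs
    by (intro integral_subset_le) (auto simp: computation_power_def)
qed

lemma cum_power_continuous:
  assumes "computation_power v"
  shows "continuous_on {0..} (cum_power v)"
  unfolding continuous_on_eq_continuous_within
proof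
  fix t :: real assume t: "t \<in> {0..}"
  have "continuous_on {0..t + 1} (cum_power v)"
    unfolding cum_power_def[abs_def] using assms t
    by (intro indefinite_integral_continuous_1) (auto simp: computation_power_def)
  then have "continuous (at t within {0..t + 1}) (cum_power v)"
    using t by (auto simp: continuous_on_eq_continuous_within)
  moreover have "at t within {0..t + 1} = at t within {0..}"
    by (rule at_within_nhd[of t "{..<t + 1}"]) auto
  ultimately show "continuous (at t within {0..}) (cum_power v)" by simp
qed

text \<open>
  The floor of a continuous function is upper semicontinuous, so the set of admissible times is
  closed and its infimum is a minimum.
\<close>

lemma min_time_le:
  fixes V :: "nat \<Rightarrow> real \<Rightarrow> real"
  assumes cont: "\<And>i. i \<in> {1..n} \<Longrightarrow> continuous_on {0..} (V i)"
    and t: "0 \<le> t" "m \<le> real_of_int (\<Sum>i=1..n. \<lfloor>V i t - c i\<rfloor>)"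
  shows "\<exists>s. min_time (\<lambda>t. m \<le> real_of_int (\<Sum>i=1..n. \<lfloor>V i t - c i\<rfloor>)) = ereal s \<and> 0 \<le> s \<and> s \<le> t \<and>
    m \<le> real_of_int (\<Sum>i=1..n. \<lfloor>V i s - c i\<rfloor>)"
proof -
  define P where "P t \<longleftrightarrow> m \<le> real_of_int (\<Sum>i=1..n. \<lfloor>V i t - c i\<rfloor>)" for t
  define s where "s = Inf {t. 0 \<le> t \<and> P t}"
  have bdd: "bdd_below {t. 0 \<le> t \<and> P t}" by (rule bdd_belowI[of _ 0]) simp
  have ne: "{t. 0 \<le> t \<and> P t} \<noteq> {}" using t by (auto simp: P_def)
  have s0: "0 \<le> s" unfolding s_def using ne by (intro cInf_greatest) auto
  have lower: "s \<le> r" if "0 \<le> r" "P r" for r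
    unfolding s_def using bdd that by (intro cInf_lower) auto
  have "\<forall>\<^sub>F r in at s within {0..}. \<forall>i\<in>{1..n}. V i r < of_int \<lfloor>V i s - c i\<rfloor> + 1 + c i"
  proof (rule eventually_ball_finite)
    show "\<forall>i\<in>{1..n}. \<forall>\<^sub>F r in at s within {0..}. V i r < of_int \<lfloor>V i s - c i\<rfloor> + 1 + c i"
    proof
      fix i assume i: "i \<in> {1..n}"
      have "(V i \<longlongrightarrow> V i s) (at s within {0..})"
        using cont[OF i] s0 by (auto simp: continuous_on_def)
      then show "\<forall>\<^sub>F r in at s within {0..}. V i r < of_int \<lfloor>V i s - c i\<rfloor> + 1 + c i"
        by (rule order_tendstoD) linarith
    qed
  qed simp
  then obtain d where d: "d > 0" and near: "\<And>r i. 0 \<le> r \<Longrightarrow> r \<noteq> s \<Longrightarrow> dist r s < d \<Longrightarrow> i \<in> {1..n} \<Longrightarrow>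
      V i r < of_int \<lfloor>V i s - c i\<rfloor> + 1 + c i"
    unfolding eventually_at by (auto 5 3)
  obtain r where r: "0 \<le> r" "P r" "r < s + d"
    using cInf_lessD[OF ne, of "s + d"] d unfolding s_def by auto
  have Ps: "P s"
  proof (cases "r = s")
    case False
    have "dist r s < d" using r lower[OF r(1,2)] by (simp add: dist_real_def)
    then have "\<lfloor>V i r - c i\<rfloor> \<le> \<lfloor>V i s - c i\<rfloor>" if "i \<in> {1..n}" for i
      using near[OF r(1) False _ that] by linarith
    then have "(\<Sum>i=1..n. \<lfloor>V i r - c i\<rfloor>) \<le> (\<Sum>i=1..n. \<lfloor>V i s - c i\<rfloor>)"
      by (rule sum_mono)
    then show ?thesis using r(2) by (simp add: P_def del: of_int_sum)
  qed (use r in simp)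
  have "(LEAST t. 0 \<le> t \<and> P t) = s"
    using s0 Ps lower by (intro Least_equality) auto
  then have "min_time P = ereal s"
    using s0 Ps by (auto simp: min_time_def)
  then show ?thesis
    using s0 Ps lower[of t] t by (auto simp: P_def[abs_def])
qed

lemma lower_time_cases:
  assumes cont: "\<And>i. i \<in> {1..n} \<Longrightarrow> continuous_on {0..} (V i)"
  shows "lower_time n V m k = \<infinity> \<or> (\<exists>a\<ge>0. lower_time n V m k = ereal a)"
proof (cases k)
  case (Suc j)
  show ?thesis
  proof (cases "lower_time n V m k = \<infinity>")
    case False
    let ?P = "\<lambda>t. m \<le> real_of_int (\<Sum>i=1..n. \<lfloor>V i t - V i (real_of_ereal (lower_time n V m j))\<rfloor>)"
    have eq: "lower_time n V m k = min_time ?P" using False unfolding Suc by (auto split: if_splits)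
    then obtain t where "t \<ge> 0" "?P t" using False by (auto simp: min_time_def split: if_splits)
    from min_time_le[where V = V and n = n and m = m, OF cont this] show ?thesis
      unfolding eq by auto
  qed simp
qed (simp add: zero_ereal_def)

text \<open>
  The recursion may be restarted at any time \<open>\<tau>\<close> after the \<open>k\<close>th lower time: a later start only
  decreases the amount of work done by time \<open>t\<close>.
\<close>

lemma lower_time_Suc_le:
  assumes mono: "\<And>i. i \<in> {1..n} \<Longrightarrow> mono_on {0..} (V i)"
    and cont: "\<And>i. i \<in> {1..n} \<Longrightarrow> continuous_on {0..} (V i)"
    and \<tau>: "lower_time n V m k \<le> ereal \<tau>" "0 \<le> \<tau>" "0 \<le> t"
    and m: "m \<le> real_of_int (\<Sum>i=1..n. \<lfloor>V i t - V i \<tau>\<rfloor>)"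
  shows "lower_time n V m (Suc k) \<le> ereal t"
proof -
  obtain a where a: "0 \<le> a" "lower_time n V m k = ereal a"
    using lower_time_cases[of n V m k, OF cont] \<tau> by auto
  have "a \<le> \<tau>" using a \<tau> by simp
  then have "V i a \<le> V i \<tau>" if "i \<in> {1..n}" for i
    using mono_onD[OF mono[OF that]] a \<tau> by simp
  then have "(\<Sum>i=1..n. \<lfloor>V i t - V i \<tau>\<rfloor>) \<le> (\<Sum>i=1..n. \<lfloor>V i t - V i a\<rfloor>)"
    by (intro sum_mono floor_mono) auto
  then have "m \<le> real_of_int (\<Sum>i=1..n. \<lfloor>V i t - V i a\<rfloor>)" using m by linarith
  from min_time_le[where V = V and n = n and m = m, OF cont \<tau>(3) this] show ?thesis
    using a by auto
qed

lemma lower_time_le_Suc: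
  assumes mono: "\<And>i. i \<in> {1..n} \<Longrightarrow> mono_on {0..} (V i)"
    and cont: "\<And>i. i \<in> {1..n} \<Longrightarrow> continuous_on {0..} (V i)"
    and m: "m > 0"
  shows "lower_time n V m k \<le> lower_time n V m (Suc k)"
    and "0 < lower_time n V m (Suc k)"
proof -
  have "lower_time n V m k \<le> lower_time n V m (Suc k) \<and> 0 < lower_time n V m (Suc k)"
  proof (cases "lower_time n V m (Suc k) = \<infinity>")
    case False
    then obtain a where a: "0 \<le> a" "lower_time n V m k = ereal a"
      using lower_time_cases[of n V m k, OF cont] by auto
    let ?P = "\<lambda>t. m \<le> real_of_int (\<Sum>i=1..n. \<lfloor>V i t - V i a\<rfloor>)"
    have eq: "lower_time n V m (Suc k) = min_time ?P" using a by simp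
    then obtain t where "t \<ge> 0" "?P t" using False by (auto simp: min_time_def split: if_splits)
    from min_time_le[where V = V and n = n and m = m, OF cont this]
    obtain s where s: "lower_time n V m (Suc k) = ereal s" "0 \<le> s" "?P s" unfolding eq by auto
    have "a < s"
    proof (rule ccontr)
      assume "\<not> a < s"
      then have "V i s \<le> V i a" if "i \<in> {1..n}" for i
        using mono_onD[OF mono[OF that], of s a] a s by simp
      then have "(\<Sum>i=1..n. \<lfloor>V i s - V i a\<rfloor>) \<le> 0" by (intro sum_nonpos) force
      then show False using s(3) m by linarith
    qed
    then show ?thesis using a s by simp
  qed simp
  then show "lower_time n V m k \<le> lower_time n V m (Suc k)" "0 < lower_time n V m (Suc k)" by auto
qed

section \<open>Independent coins\<close>

definition coin :: "real \<Rightarrow> real measure" where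
  "coin p = distr (measure_pmf (bernoulli_pmf p)) (count_space {0, 1}) of_bool"

lemma sets_coin [measurable_cong]: "sets (coin p) = sets (count_space {0, 1})"
  by (simp add: coin_def)

lemma prob_space_coin: "prob_space (coin p)"
  unfolding coin_def by (intro prob_space.prob_space_distr prob_space_measure_pmf) auto

lemma nn_integral_coin:
  assumes "0 \<le> p" "p \<le> 1"
  shows "(\<integral>\<^sup>+\<xi>. f \<xi> \<partial>coin p) = f 1 * ennreal p + f 0 * ennreal (1 - p)"
  unfolding coin_def using assms by (subst nn_integral_distr) auto

lemma integrable_coin: "integrable (coin p) (f :: real \<Rightarrow> real)"
  unfolding coin_def by (subst integrable_distr_eq) (auto intro: integrable_measure_pmf_finite)

lemma integral_coin:
  fixes f :: "real \<Rightarrow> real"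
  assumes "0 \<le> p" "p \<le> 1"
  shows "(\<integral>\<xi>. f \<xi> \<partial>coin p) = f 1 * p + f 0 * (1 - p)"
  unfolding coin_def using assms by (subst integral_distr) auto

lemma Ionescu_Tulcea_const:
  assumes "prob_space B"
  shows "Ionescu_Tulcea (\<lambda>_ _. B) (\<lambda>_. B)"
proof (rule Ionescu_Tulcea.intro)
  show "(\<lambda>_. B) \<in> PiM {0..<i} (\<lambda>_. B) \<rightarrow>\<^sub>M subprob_algebra B" for i
    using assms by (intro measurable_const) (simp add: space_subprob_algebra prob_space_imp_subprob_space)
qed (rule assms)

text \<open>
  For kernels that ignore the past, all finite-dimensional distributions are products, and these
  determine the infinite product measure.
\<close>

lemma Ionescu_Tulcea_const_lim:
  assumes "prob_space B"
  shows "projective_family.lim UNIV (Ionescu_Tulcea.CI (\<lambda>_ _. B) (\<lambda>_. B)) (\<lambda>_. B) = PiM UNIV (\<lambda>_::nat. B)"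
proof -
  interpret IT: Ionescu_Tulcea "\<lambda>_ _. B" "\<lambda>_. B"
    by (rule Ionescu_Tulcea_const[OF assms])
  interpret B: prob_space B by fact
  interpret P: product_prob_space "\<lambda>_::nat. B" UNIV by standard
  have C: "IT.C 0 k (\<lambda>_. undefined) = PiM {0..<k} (\<lambda>_. B)" for k
  proof (induction k)
    case 0 then show ?case
      by (auto simp: PiM_empty intro!: measure_eqI dest!: subset_singletonD)
  next
    case (Suc k) then show ?case
      apply (auto intro!: measure_eqI simp: sets_bind[OF IT.sets_eP] emeasure_bind[OF _ IT.measurable_eP])
      apply (auto simp: P.product_nn_integral_insert nn_integral_indicator[symmetric] atLeastLessThanSuc
          IT.emeasure_eP space_PiM split: split_indicator simp del: nn_integral_indicator intro!: nn_integral_cong)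
      done
  qed
  have CI: "IT.CI J = PiM J (\<lambda>_. B)" if "finite J" for J
    by (auto simp: IT.up_to_less that IT.CI_def C intro!: P.distr_restrict[symmetric])
  show ?thesis
  proof (rule P.PiM_eq)
    show "sets IT.PF.lim = sets (PiM UNIV (\<lambda>_. B))" by (rule IT.PF.sets_lim)
    fix J :: "nat set" and F :: "nat \<Rightarrow> 'a set"
    assume J: "finite J" "\<And>j. j \<in> J \<Longrightarrow> F j \<in> sets B"
    then show "emeasure IT.PF.lim (prod_emb UNIV (\<lambda>_. B) J (Pi\<^sub>E J F)) = (\<Prod>j\<in>J. emeasure B (F j))"
      by (subst IT.lim) (auto simp: CI P.emeasure_PiM intro!: sets_PiM_I_finite)
  qed
qed

lemma sample_kernel_const: "sample_kernel A V g (\<lambda>_ _ _. B) = (\<lambda>_ _. B)"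
  by (intro ext) (simp add: sample_kernel_def Let_def split: prod.splits)

lemma sample_law_const:
  assumes "prob_space B"
  shows "sample_law A V g B (\<lambda>_ _ _. B) = PiM UNIV (\<lambda>_. B)"
  unfolding sample_law_def sample_kernel_const using assms by (rule Ionescu_Tulcea_const_lim)

definition determined_by :: "nat \<Rightarrow> ((nat \<Rightarrow> real) \<Rightarrow> 'b) \<Rightarrow> bool" where
  "determined_by k F \<longleftrightarrow> (\<forall>\<omega> \<omega>'. (\<forall>j<k. \<omega> j = \<omega>' j) \<longrightarrow> F \<omega> = F \<omega>')"

lemma determined_by_restrict: "determined_by k F \<Longrightarrow> F (restrict \<omega> {..<k}) = F \<omega>"
  unfolding determined_by_def by auto

lemma determined_byD: "determined_by k F \<Longrightarrow> (\<And>j. j < k \<Longrightarrow> \<omega> j = \<omega>' j) \<Longrightarrow> F \<omega> = F \<omega>'"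
  unfolding determined_by_def by blast

lemma determined_by_compose: "determined_by k F \<Longrightarrow> determined_by k (\<lambda>\<omega>. h (F \<omega>))"
  unfolding determined_by_def by metis

lemma determined_by_success:
  assumes "determined_by k H"
  shows "determined_by (Suc k) (\<lambda>\<omega>. H \<omega> \<and> \<omega> k \<noteq> 0)"
  unfolding determined_by_def
proof (intro allI impI)
  fix \<omega> \<omega>' :: "nat \<Rightarrow> real" assume eq: "\<forall>j<Suc k. \<omega> j = \<omega>' j"
  then have "H \<omega> = H \<omega>'" by (intro determined_byD[OF assms]) simp
  with eq show "(H \<omega> \<and> \<omega> k \<noteq> 0) = (H \<omega>' \<and> \<omega>' k \<noteq> 0)" by simp
qed

abbreviation coins :: "real \<Rightarrow> (nat \<Rightarrow> real) measure" where
  "coins p \<equiv> PiM UNIV (\<lambda>_. coin p)"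

text \<open>
  Finitely many coins form a finite discrete space.
\<close>

lemma measurable_finite_coins:
  fixes F :: "(nat \<Rightarrow> real) \<Rightarrow> 'a" and k :: nat
  shows "F \<in> PiM {..<k} (\<lambda>_. coin p) \<rightarrow>\<^sub>M count_space UNIV"
proof -
  have "sets (PiM {..<k} (\<lambda>_. coin p)) = sets (PiM {..<k} (\<lambda>_. count_space {0, 1}))"
    by (intro sets_PiM_cong) (simp_all add: sets_coin)
  also have "PiM {..<k} (\<lambda>_. count_space {0, 1 :: real}) = count_space (PiE {..<k} (\<lambda>_. {0, 1}))"
    by (rule count_space_PiM_finite) auto
  finally have "PiM {..<k} (\<lambda>_. coin p) \<rightarrow>\<^sub>M count_space UNIV =
      count_space (PiE {..<k} (\<lambda>_. {0, 1})) \<rightarrow>\<^sub>M (count_space UNIV :: 'a measure)"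
    by (rule measurable_cong_sets) simp
  then show ?thesis by simp
qed

lemma measurable_determined_by:
  assumes "determined_by k F"
  shows "F \<in> coins p \<rightarrow>\<^sub>M count_space UNIV"
proof -
  have "(\<lambda>\<omega>. F (restrict \<omega> {..<k})) \<in> coins p \<rightarrow>\<^sub>M count_space UNIV"
    by (rule measurable_compose[OF measurable_restrict_subset measurable_finite_coins]) simp
  then show ?thesis by (simp add: determined_by_restrict[OF assms])
qed

lemma emeasure_coins_fresh:
  assumes p: "0 \<le> p" "p \<le> 1" and H: "determined_by k H"
  shows "emeasure (coins p) {\<omega> \<in> space (coins p). H \<omega> \<and> \<omega> k \<noteq> 0} =
    ennreal p * emeasure (coins p) {\<omega> \<in> space (coins p). H \<omega>}"
proof -
  interpret B: prob_space "coin p" by (rule prob_space_coin)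
  interpret P: product_prob_space "\<lambda>_::nat. coin p" UNIV by standard
  have finite_nn: "(\<integral>\<^sup>+\<omega>. f (restrict \<omega> {..<l}) \<partial>coins p) = (\<integral>\<^sup>+\<omega>. f \<omega> \<partial>PiM {..<l} (\<lambda>_. coin p))"
    for f :: "(nat \<Rightarrow> real) \<Rightarrow> ennreal" and l
  proof -
    have "f \<in> borel_measurable (PiM {..<l} (\<lambda>_. coin p))"
      by (rule measurable_compose[OF measurable_finite_coins]) auto
    then show ?thesis
      by (subst P.distr_PiM_restrict_finite[of "{..<l}", symmetric])
        (auto intro!: nn_integral_distr[symmetric] measurable_restrict_subset)
  qed
  let ?f = "\<lambda>\<omega>. of_bool (H \<omega> \<and> \<omega> k \<noteq> 0) :: ennreal" and ?h = "\<lambda>\<omega>. of_bool (H \<omega>) :: ennreal"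
  have det: "determined_by (Suc k) (\<lambda>\<omega>. H \<omega> \<and> \<omega> k \<noteq> 0)"
    by (rule determined_by_success[OF H])
  have f: "determined_by (Suc k) ?f" and h: "determined_by k ?h"
    by (rule determined_by_compose[OF det], rule determined_by_compose[OF H])
  have meas: "{\<omega> \<in> space (coins p). G \<omega>} \<in> sets (coins p)" if "determined_by l G" for l G
    using measurable_determined_by[OF that, of p] by measurable
  have upd: "H (x(k := y)) = H x" for x y
    by (rule determined_byD[OF H]) simp
  have "emeasure (coins p) {\<omega> \<in> space (coins p). H \<omega> \<and> \<omega> k \<noteq> 0} = (\<integral>\<^sup>+\<omega>. ?f \<omega> \<partial>coins p)"
    by (subst nn_integral_indicator[OF meas[OF det], symmetric]) (auto intro!: nn_integral_cong)
  also have "\<dots> = (\<integral>\<^sup>+\<omega>. ?f (restrict \<omega> {..<Suc k}) \<partial>coins p)"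
    by (simp only: determined_by_restrict[OF f])
  also have "\<dots> = (\<integral>\<^sup>+\<omega>. ?f \<omega> \<partial>PiM (insert k {..<k}) (\<lambda>_. coin p))"
    unfolding lessThan_Suc[symmetric] by (rule finite_nn)
  also have "\<dots> = (\<integral>\<^sup>+x. (\<integral>\<^sup>+y. ?f (x(k := y)) \<partial>coin p) \<partial>PiM {..<k} (\<lambda>_. coin p))"
  proof (rule P.product_nn_integral_insert)
    show "?f \<in> borel_measurable (PiM (insert k {..<k}) (\<lambda>_. coin p))"
      unfolding lessThan_Suc[symmetric] by (rule measurable_compose[OF measurable_finite_coins]) auto
  qed auto
  also have "\<dots> = (\<integral>\<^sup>+x. ennreal p * ?h x \<partial>PiM {..<k} (\<lambda>_. coin p))"
    unfolding nn_integral_coin[OF p] upd by (intro nn_integral_cong) auto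
  also have "\<dots> = ennreal p * (\<integral>\<^sup>+x. ?h x \<partial>PiM {..<k} (\<lambda>_. coin p))"
    by (intro nn_integral_cmult measurable_compose[OF measurable_finite_coins]) auto
  also have "\<dots> = ennreal p * (\<integral>\<^sup>+\<omega>. ?h \<omega> \<partial>coins p)"
    by (simp only: finite_nn[symmetric] determined_by_restrict[OF h])
  also have "(\<integral>\<^sup>+\<omega>. ?h \<omega> \<partial>coins p) = emeasure (coins p) {\<omega> \<in> space (coins p). H \<omega>}"
    by (subst nn_integral_indicator[OF meas[OF H], symmetric]) (auto intro!: nn_integral_cong)
  finally show ?thesis .
qed

text \<open>
  Let \<open>E l\<close> be the event that coin \<open>l\<close> is an attempt, decided before that coin is tossed. If there
  are never more than \<open>C\<close> attempts, then the expected number of successful ones is at most \<open>p C\<close>, and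
  Markov's inequality applies. The events for \<open>k\<close> steps increase with \<open>k\<close>, so the same bound holds for
  their union.
\<close>

lemma coins_success_count:
  fixes E :: "nat \<Rightarrow> (nat \<Rightarrow> real) \<Rightarrow> bool" and a :: real
  assumes p: "0 \<le> p" "p \<le> 1" and a: "0 < a"
    and E: "\<And>l. determined_by l (E l)"
    and C: "\<And>\<omega> k. (\<Sum>l<k. of_bool (E l \<omega>)) \<le> (C :: nat)"
  shows "{\<omega> \<in> space (coins p). \<exists>k. a \<le> (\<Sum>l<k. of_bool (E l \<omega> \<and> \<omega> l \<noteq> 0))} \<in> sets (coins p)"
    and "measure (coins p) {\<omega> \<in> space (coins p). \<exists>k. a \<le> (\<Sum>l<k. of_bool (E l \<omega> \<and> \<omega> l \<noteq> 0))} \<le> p * C / a"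
    (is "measure _ ?U \<le> _")
proof -
  interpret B: prob_space "coin p" by (rule prob_space_coin)
  interpret P: product_prob_space "\<lambda>_::nat. coin p" UNIV by standard
  have det: "determined_by (Suc l) (\<lambda>\<omega>. E l \<omega> \<and> \<omega> l \<noteq> 0)" for l
    by (rule determined_by_success[OF E])
  note [measurable] = measurable_determined_by[OF E] measurable_determined_by[OF det]
  define X where "X k \<omega> = (\<Sum>l<k. of_bool (E l \<omega> \<and> \<omega> l \<noteq> 0) :: real)" for k \<omega>
  have [measurable]: "X k \<in> borel_measurable (coins p)" for k
    unfolding X_def by measurable
  define U where "U k = {\<omega> \<in> space (coins p). a \<le> X k \<omega>}" for k
  have [measurable]: "U k \<in> sets (coins p)" for k unfolding U_def by measurable
  have bound: "emeasure (coins p) (U k) \<le> ennreal (p * C / a)" for k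
  proof -
    have "ennreal a * emeasure (coins p) (U k) = (\<integral>\<^sup>+\<omega>. ennreal a * indicator (U k) \<omega> \<partial>coins p)"
      by (simp add: nn_integral_cmult)
    also have "\<dots> \<le> (\<integral>\<^sup>+\<omega>. (\<Sum>l<k. indicator {\<omega> \<in> space (coins p). E l \<omega> \<and> \<omega> l \<noteq> 0} \<omega>) \<partial>coins p)"
    proof (rule nn_integral_mono)
      fix \<omega> assume \<omega>: "\<omega> \<in> space (coins p)"
      have "(\<Sum>l<k. indicator {\<omega> \<in> space (coins p). E l \<omega> \<and> \<omega> l \<noteq> 0} \<omega> :: ennreal) = ennreal (X k \<omega>)"
        using \<omega> unfolding X_def by (simp add: indicator_def ennreal_of_nat_eq_real_of_nat)
      then show "ennreal a * indicator (U k) \<omega> \<le>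
          (\<Sum>l<k. indicator {\<omega> \<in> space (coins p). E l \<omega> \<and> \<omega> l \<noteq> 0} \<omega>)"
        by (auto simp: U_def indicator_def intro!: ennreal_leI)
    qed
    also have "\<dots> = (\<Sum>l<k. emeasure (coins p) {\<omega> \<in> space (coins p). E l \<omega> \<and> \<omega> l \<noteq> 0})"
      by (subst nn_integral_sum) auto
    also have "\<dots> = (\<Sum>l<k. ennreal p * emeasure (coins p) {\<omega> \<in> space (coins p). E l \<omega>})"
      using emeasure_coins_fresh[OF p E] by simp
    also have "\<dots> = ennreal p * (\<integral>\<^sup>+\<omega>. (\<Sum>l<k. indicator {\<omega> \<in> space (coins p). E l \<omega>} \<omega>) \<partial>coins p)"
      by (subst nn_integral_sum) (auto simp: sum_distrib_left)
    also have "\<dots> \<le> ennreal p * (\<integral>\<^sup>+\<omega>. ennreal C \<partial>coins p)"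
    proof (intro mult_left_mono nn_integral_mono)
      fix \<omega> assume \<omega>: "\<omega> \<in> space (coins p)"
      have "(\<Sum>l<k. indicator {\<omega> \<in> space (coins p). E l \<omega>} \<omega> :: ennreal) = of_nat (\<Sum>l<k. of_bool (E l \<omega>))"
        using \<omega> by (auto simp: indicator_def intro!: sum.cong)
      also have "\<dots> \<le> of_nat C" using C by (simp only: of_nat_mono)
      finally show "(\<Sum>l<k. indicator {\<omega> \<in> space (coins p). E l \<omega>} \<omega>) \<le> ennreal C"
        by (simp add: ennreal_of_nat_eq_real_of_nat)
    qed simp
    also have "\<dots> = ennreal (p * C)" using p by (simp add: P.P.emeasure_space_1 ennreal_mult)
    finally have "ennreal (a * measure (coins p) (U k)) \<le> ennreal (p * C)"
      using a by (simp add: P.P.emeasure_eq_measure ennreal_mult)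
    then have "a * measure (coins p) (U k) \<le> p * C" using p by (simp add: ennreal_le_iff)
    then show ?thesis
      using a p by (simp add: P.P.emeasure_eq_measure field_simps ennreal_leI)
  qed
  have "incseq U"
    by (rule incseq_SucI) (auto simp: U_def X_def)
  then have "emeasure (coins p) (\<Union>k. U k) = (SUP k. emeasure (coins p) (U k))"
    by (intro SUP_emeasure_incseq[symmetric]) auto
  also have "\<dots> \<le> ennreal (p * C / a)" by (intro SUP_least bound)
  finally have "emeasure (coins p) (\<Union>k. U k) \<le> ennreal (p * C / a)" .
  moreover have "(\<Union>k. U k) = ?U" by (auto simp: U_def X_def)
  moreover have "(\<Union>k. U k) \<in> sets (coins p)" by auto
  ultimately show "?U \<in> sets (coins p)" "measure (coins p) ?U \<le> p * C / a"
    using p a by (simp_all add: P.P.emeasure_eq_measure)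
qed

text \<open>
  The random index set always contains \<open>0\<close>, and the value at step \<open>0\<close> is deterministic. If it is
  used in place of the excluded values, the infimum becomes one over all steps, which gives
  measurability and boundedness.
\<close>

lemma coins_expectation_INF_ge:
  fixes \<tau> q :: "(nat \<Rightarrow> real) \<Rightarrow> nat \<Rightarrow> real" and t :: ereal and b :: real
  assumes \<tau>: "\<And>k. determined_by k (\<lambda>\<omega>. \<tau> \<omega> k)" and q: "\<And>k. determined_by k (\<lambda>\<omega>. q \<omega> k)"
    and q0: "\<And>\<omega> k. 0 \<le> q \<omega> k" and \<tau>0: "\<And>\<omega>. ereal (\<tau> \<omega> 0) \<le> t"
    and U: "U \<in> sets (coins p)" "measure (coins p) U \<le> 1 / 2"
    and b: "0 \<le> b" "\<And>\<omega> k. \<omega> \<in> space (coins p) \<Longrightarrow> \<omega> \<notin> U \<Longrightarrow> ereal (\<tau> \<omega> k) \<le> t \<Longrightarrow> b \<le> q \<omega> k"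
  shows "b / 2 \<le> (\<integral>\<omega>. (INF k \<in> {k. ereal (\<tau> \<omega> k) \<le> t}. q \<omega> k) \<partial>coins p)"
proof -
  interpret B: prob_space "coin p" by (rule prob_space_coin)
  interpret P: product_prob_space "\<lambda>_::nat. coin p" UNIV by standard
  define \<phi> where "\<phi> k \<omega> = (if ereal (\<tau> \<omega> k) \<le> t then q \<omega> k else q \<omega> 0)" for k \<omega>
  let ?I = "\<lambda>\<omega>. INF k \<in> {k. ereal (\<tau> \<omega> k) \<le> t}. q \<omega> k"
  have bdd: "bdd_below (q \<omega> ` K)" for \<omega> K using q0 by (intro bdd_belowI2[of _ 0]) auto
  have bdd': "bdd_below (range (\<lambda>k. \<phi> k \<omega>))" for \<omega>
    using q0 by (intro bdd_belowI2[of _ 0]) (auto simp: \<phi>_def)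
  have I: "?I \<omega> = (INF k. \<phi> k \<omega>)" for \<omega>
  proof -
    have "q \<omega> ` {k. ereal (\<tau> \<omega> k) \<le> t} = range (\<lambda>k. \<phi> k \<omega>)"
      using \<tau>0[of \<omega>] by (auto simp: \<phi>_def image_iff)
    then show ?thesis by simp
  qed
  have q00: "q \<omega> 0 = q (\<lambda>_. 0) 0" for \<omega> using q[of 0] by (rule determined_byD) simp
  have "determined_by k (\<phi> k)" for k
    unfolding determined_by_def
  proof (intro allI impI)
    fix \<omega> \<omega>' :: "nat \<Rightarrow> real" assume eq: "\<forall>j<k. \<omega> j = \<omega>' j"
    have "\<tau> \<omega> k = \<tau> \<omega>' k" by (rule determined_byD[OF \<tau>]) (use eq in blast)
    moreover have "q \<omega> k = q \<omega>' k" by (rule determined_byD[OF q]) (use eq in blast)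
    moreover have "q \<omega> 0 = q \<omega>' 0" by (rule determined_byD[OF q]) simp
    ultimately show "\<phi> k \<omega> = \<phi> k \<omega>'" unfolding \<phi>_def by (simp only:)
  qed
  from measurable_determined_by[OF this]
  have [measurable]: "\<phi> k \<in> borel_measurable (coins p)" for k
    by (rule measurable_compose) auto
  have [measurable]: "?I \<in> borel_measurable (coins p)"
    unfolding I using bdd' by (intro borel_measurable_cINF) auto
  have I_nonneg: "0 \<le> ?I \<omega>" for \<omega> using q0 \<tau>0[of \<omega>] by (intro cINF_greatest) auto
  have I_le: "?I \<omega> \<le> q (\<lambda>_. 0) 0" for \<omega>
    unfolding q00[of \<omega>, symmetric] using bdd \<tau>0[of \<omega>] by (intro cINF_lower) auto
  have int: "integrable (coins p) ?I"
    using I_nonneg I_le by (intro P.P.integrable_const_bound[of _ "q (\<lambda>_. 0) 0"]) auto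
  have "b / 2 \<le> b * (1 - measure (coins p) U)"
    using mult_left_mono[of "1 / 2" "1 - measure (coins p) U" b] U b by simp
  also have "\<dots> = b * measure (coins p) (space (coins p) - U)"
    using U by (subst P.P.prob_compl) auto
  also have "\<dots> = (\<integral>\<omega>. b * indicator (space (coins p) - U) \<omega> \<partial>coins p)"
    using U by simp
  also have "\<dots> \<le> (\<integral>\<omega>. ?I \<omega> \<partial>coins p)"
  proof (rule integral_mono[OF _ int])
    show "integrable (coins p) (\<lambda>\<omega>. b * indicator (space (coins p) - U) \<omega>)"
      using U by (intro integrable_mult_right integrable_real_indicator) (auto simp: P.P.emeasure_eq_measure)
    fix \<omega> assume "\<omega> \<in> space (coins p)"
    then have "b \<le> ?I \<omega>" if "\<omega> \<notin> U"
      using \<tau>0[of \<omega>] b that by (intro cINF_greatest) auto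
    then show "b * indicator (space (coins p) - U) \<omega> \<le> ?I \<omega>"
      using I_nonneg by (auto simp: indicator_def)
  qed
  finally show ?thesis .
qed

section \<open>Progress of a zero-respecting run\<close>

lemma protocol_cong:
  "\<forall>j<k. \<omega> j = \<omega>' j \<Longrightarrow> protocol A V g \<omega> k = protocol A V g \<omega>' k"
  by (induction k) (simp_all add: Let_def split: prod.splits)

lemma proto_time_cong:
  "\<forall>j<k. \<omega> j = \<omega>' j \<Longrightarrow> proto_time A V g \<omega> k = proto_time A V g \<omega>' k"
  using protocol_cong[of _ \<omega> \<omega>'] by (simp add: proto_time_def split: nat.splits)

lemma proto_point_cong:
  "\<forall>j<k. \<omega> j = \<omega>' j \<Longrightarrow> proto_point A V g \<omega> k = proto_point A V g \<omega>' k"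
  using protocol_cong[of _ \<omega> \<omega>'] by (simp add: proto_point_def)

text \<open>
  A run against an oracle that can reveal at most one new coordinate per gradient, and reveals
  none if the sample is \<open>0\<close>. The threshold \<open>m\<close> is the one in the recursion for the lower times; \<open>M\<close>
  is an integer version of it, to be compared with numbers of gradients.
\<close>

locale chain_run =
  fixes A :: algorithm and V :: "nat \<Rightarrow> real \<Rightarrow> real"
    and g :: "nat \<Rightarrow> vec \<Rightarrow> real \<Rightarrow> real \<Rightarrow> vec"
    and n T M :: nat and m :: real
  assumes zero_respecting: "zero_respecting T n A"
    and V_mono: "\<And>i. i \<in> {1..n} \<Longrightarrow> mono_on {0..} (V i)"
    and V_cont: "\<And>i. i \<in> {1..n} \<Longrightarrow> continuous_on {0..} (V i)"
    and m_pos: "0 < m" and m_le: "m \<le> real M"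
    and g_Rd: "\<And>i x \<xi> t. x \<in> Rd T \<Longrightarrow> g i x \<xi> t \<in> Rd T"
    and g_chain: "\<And>i x \<xi> t r j. x \<in> Rd T \<Longrightarrow> \<forall>j>r. x j = 0 \<Longrightarrow> j > Suc r \<Longrightarrow> g i x \<xi> t j = 0"
    and g_silent: "\<And>i x t r j. x \<in> Rd T \<Longrightarrow> \<forall>j>r. x j = 0 \<Longrightarrow> j > r \<Longrightarrow> g i x 0 t j = 0"
begin

text \<open>
  The step returns a gradient that was computed at a point using coordinate \<open>r\<close>. If \<open>r\<close>
  coordinates have been revealed, only such a gradient can reveal another one.
\<close>

definition useful :: "(nat \<Rightarrow> real) \<Rightarrow> nat \<Rightarrow> nat \<Rightarrow> bool" where
  "useful \<omega> k r \<longleftrightarrow>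
     (let (s, gs) = protocol A V g \<omega> k; (t, i, c, x) = A gs; (st, sx, sq) = s i
      in \<not> c \<and> sq \<and> 1 \<le> V i t - V i st \<and> r < T \<and> (r = 0 \<or> sx r \<noteq> 0))"

text \<open>
  The components are the number \<open>R\<close> of revealed coordinates, the number \<open>S\<close> of lucky reveals, that
  is, those that took fewer than \<open>M\<close> useful gradients, the number \<open>N i\<close> of useful gradients from worker
  \<open>i\<close> since the last reveal, and the time \<open>\<tau>\<close> of the last reveal. A useful gradient with a nonzero
  sample always counts as a reveal, so \<open>R\<close> is an upper bound on the true progress.
\<close>

primrec track :: "(nat \<Rightarrow> real) \<Rightarrow> nat \<Rightarrow> nat \<times> nat \<times> (nat \<Rightarrow> nat) \<times> real" where
  "track \<omega> 0 = (0, 0, (\<lambda>_. 0), 0)"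
| "track \<omega> (Suc k) =
     (let (R, S, N, \<tau>) = track \<omega> k; (t, i, c, x) = A (snd (protocol A V g \<omega> k))
      in if \<not> useful \<omega> k R then (R, S, N, \<tau>)
         else if \<omega> k = 0 then (R, S, N(i := Suc (N i)), \<tau>)
         else (Suc R, if Suc (\<Sum>i=1..n. N i) < M then Suc S else S, (\<lambda>_. 0), t))"

definition reveals :: "(nat \<Rightarrow> real) \<Rightarrow> nat \<Rightarrow> nat" where
  "reveals \<omega> k = fst (track \<omega> k)"

definition lucky :: "(nat \<Rightarrow> real) \<Rightarrow> nat \<Rightarrow> nat" where
  "lucky \<omega> k = fst (snd (track \<omega> k))"

text \<open>
  Exactly in these steps a nonzero sample produces a lucky reveal.
\<close>

definition early_try :: "(nat \<Rightarrow> real) \<Rightarrow> nat \<Rightarrow> bool" where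
  "early_try \<omega> k \<longleftrightarrow>
     (let (R, S, N, \<tau>) = track \<omega> k in useful \<omega> k R \<and> Suc (\<Sum>i=1..n. N i) < M)"

text \<open>
  A pending computation that involves the newest coordinate was started after its reveal, and the
  useful gradients that the worker has delivered since then were completed before this start.
\<close>

definition state_ok :: "real \<Rightarrow> nat \<Rightarrow> nat \<Rightarrow> real \<Rightarrow> (real \<Rightarrow> real) \<Rightarrow> ostate \<Rightarrow> bool" where
  "state_ok now R N \<tau> W = (\<lambda>(st, sx, sq). sq \<longrightarrow>
     sx \<in> Rd T \<and> (\<forall>j>R. sx j = 0) \<and> 0 \<le> st \<and> st \<le> now \<and>
     ((R = 0 \<or> sx R \<noteq> 0) \<longrightarrow> \<tau> \<le> st \<and> real N \<le> W st - W \<tau>))"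

text \<open>
  The invariant of the run. Its central clause says that the \<open>R - S\<close> reveals that were not lucky
  have advanced the recursion for the lower times by \<open>R - S\<close> steps.
\<close>

definition run_ok ::
  "real \<Rightarrow> (nat \<Rightarrow> ostate) \<times> vec list \<Rightarrow> nat \<times> nat \<times> (nat \<Rightarrow> nat) \<times> real \<Rightarrow> bool" where
  "run_ok now = (\<lambda>(s, gs) (R, S, N, \<tau>).
     set gs \<subseteq> Rd T \<and> (\<forall>u\<in>set gs. \<forall>j>R. u j = 0) \<and>
     R \<le> T \<and> S \<le> R \<and> 0 \<le> \<tau> \<and> \<tau> \<le> now \<and> lower_time n V m (R - S) \<le> ereal \<tau> \<and>
     (\<forall>i\<in>{1..n}. real (N i) \<le> V i now - V i \<tau> \<and> state_ok now R (N i) \<tau> (V i) (s i)))"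

lemma run_okD:
  assumes "run_ok now (s, gs) (R, S, N, \<tau>)" "i \<in> {1..n}"
  shows "real (N i) \<le> V i now - V i \<tau>" "state_ok now R (N i) \<tau> (V i) (s i)"
  using assms unfolding run_ok_def by blast+

lemma V_le: "i \<in> {1..n} \<Longrightarrow> 0 \<le> r \<Longrightarrow> r \<le> t \<Longrightarrow> V i r \<le> V i t"
  using mono_onD[OF V_mono] by simp

lemma state_ok_later: "state_ok now R N \<tau> W s \<Longrightarrow> now \<le> t \<Longrightarrow> state_ok t R N \<tau> W s"
  by (auto simp: state_ok_def)

lemma state_ok_idle: "state_ok t R N \<tau> W (st, sx, False)"
  by (simp add: state_ok_def)

text \<open>
  A zero-respecting algorithm cannot query a point that uses a coordinate not yet revealed.
\<close>

lemma query_facts: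
  assumes "set gs \<subseteq> Rd T" "A gs = (t, i, c, x)"
  shows "0 \<le> t" "i \<in> {1..n}" "x \<in> Rd T" "\<forall>u\<in>set gs. \<forall>j>R. u j = 0 \<Longrightarrow> \<forall>j>R. x j = 0"
    and "gs \<noteq> [] \<Longrightarrow> fst (A (butlast gs)) \<le> t"
proof -
  have *: "0 \<le> t \<and> i \<in> {1..n} \<and> x \<in> Rd T \<and> vsupp T x \<subseteq> (\<Union>g\<in>set gs. vsupp T g) \<and>
      (gs \<noteq> [] \<longrightarrow> fst (A (butlast gs)) \<le> t)"
    using assms zero_respecting unfolding zero_respecting_def by (auto simp: lists_eq_set split: prod.splits)
  then show "0 \<le> t" "i \<in> {1..n}" "x \<in> Rd T" "gs \<noteq> [] \<Longrightarrow> fst (A (butlast gs)) \<le> t" by auto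
  show "\<forall>j>R. x j = 0" if zero: "\<forall>u\<in>set gs. \<forall>j>R. u j = 0"
  proof (intro allI impI)
    fix j assume "j > R"
    then have "j \<notin> vsupp T x" using * zero unfolding vsupp_def by blast
    moreover have "j \<notin> {1..T} \<Longrightarrow> x j = 0" using * by (auto simp: Rd_def)
    ultimately show "x j = 0" by (auto simp: vsupp_def)
  qed
qed

lemma run_ok_quiet:
  assumes ok: "run_ok now (s, gs) (R, S, N, \<tau>)" and t: "now \<le> t"
    and i: "i \<in> {1..n}" and s': "state_ok t R (N i) \<tau> (V i) s'"
    and u: "u \<in> Rd T" "\<forall>j>R. u j = 0"
  shows "run_ok t (s(i := s'), gs @ [u]) (R, S, N, \<tau>)"
proof -
  have now: "0 \<le> now" using ok by (auto simp: run_ok_def)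
  have "real (N j) \<le> V j t - V j \<tau> \<and> state_ok t R (N j) \<tau> (V j) ((s(i := s')) j)" if "j \<in> {1..n}" for j
    using run_okD[OF ok that] s' V_le[OF that now t] state_ok_later[OF _ t] by auto
  then show ?thesis using ok t u by (auto simp: run_ok_def)
qed

lemma run_ok_miss:
  assumes ok: "run_ok now (s, gs) (R, S, N, \<tau>)" and t: "now \<le> t"
    and i: "i \<in> {1..n}" and st: "real (Suc (N i)) \<le> V i t - V i \<tau>"
    and u: "u \<in> Rd T" "\<forall>j>R. u j = 0"
  shows "run_ok t (s(i := (0, vzero, False)), gs @ [u]) (R, S, N(i := Suc (N i)), \<tau>)"
proof -
  have now: "0 \<le> now" using ok by (auto simp: run_ok_def)
  have "real ((N(i := Suc (N i))) j) \<le> V j t - V j \<tau> \<and>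
      state_ok t R ((N(i := Suc (N i))) j) \<tau> (V j) ((s(i := (0, vzero, False))) j)" if "j \<in> {1..n}" for j
    using run_okD[OF ok that] st V_le[OF that now t] state_ok_later[OF _ t] state_ok_idle
    by (cases "j = i") auto
  then show ?thesis using ok t u by (auto simp: run_ok_def)
qed

text \<open>
  If the reveal is not lucky, the useful gradients of all workers since \<open>\<tau>\<close>, including the present
  one, add up to at least \<open>M\<close>, so the next lower time has been reached. No computation that is pending at
  a reveal involves the new coordinate, so the new stage starts without useful work.
\<close>

lemma run_ok_hit:
  assumes ok: "run_ok now (s, gs) (R, S, N, \<tau>)" and t: "now \<le> t"
    and i: "i \<in> {1..n}" and st: "real (Suc (N i)) \<le> V i t - V i \<tau>"
    and u: "u \<in> Rd T" "\<forall>j>Suc R. u j = 0" and R: "R < T"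
  shows "run_ok t (s(i := (0, vzero, False)), gs @ [u])
    (Suc R, if Suc (\<Sum>i=1..n. N i) < M then Suc S else S, (\<lambda>_. 0), t)"
proof -
  have now: "0 \<le> now" "\<tau> \<le> now" "0 \<le> \<tau>" using ok by (auto simp: run_ok_def)
  have N: "real (N j) \<le> V j t - V j \<tau>" if "j \<in> {1..n}" for j
    using run_okD(1)[OF ok that] V_le[OF that now(1) t] by linarith
  have lower: "lower_time n V m (Suc R - (if Suc (\<Sum>i=1..n. N i) < M then Suc S else S)) \<le> ereal t"
  proof (cases "Suc (\<Sum>i=1..n. N i) < M")
    case True
    have "lower_time n V m (R - S) \<le> ereal \<tau>" using ok by (simp add: run_ok_def)
    also have "\<dots> \<le> ereal t" using now t by simp
    finally show ?thesis using True by simp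
  next
    case False
    \<comment> \<open>The present gradient is credited to its worker, so that the counts can be compared with the
      floors worker by worker.\<close>
    have "int (Suc (\<Sum>j=1..n. N j)) = (\<Sum>j=1..n. int (N j) + of_bool (j = i))"
      using i by (simp add: sum.distrib)
    also have "\<dots> \<le> (\<Sum>j=1..n. \<lfloor>V j t - V j \<tau>\<rfloor>)"
      using N st by (intro sum_mono) (auto simp: le_floor_iff)
    finally have "real_of_int (int (Suc (\<Sum>j=1..n. N j))) \<le> real_of_int (\<Sum>j=1..n. \<lfloor>V j t - V j \<tau>\<rfloor>)"
      by (simp only: of_int_le_iff)
    moreover have "m \<le> real (Suc (\<Sum>j=1..n. N j))"
      using m_le False by (meson not_less of_nat_le_iff order_trans)
    then have "m \<le> real_of_int (int (Suc (\<Sum>j=1..n. N j)))" by (simp only: of_int_of_nat_eq)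
    ultimately have "m \<le> real_of_int (\<Sum>j=1..n. \<lfloor>V j t - V j \<tau>\<rfloor>)" by linarith
    from lower_time_Suc_le[OF V_mono V_cont _ now(3) _ this, of "R - S"]
    have "lower_time n V m (Suc (R - S)) \<le> ereal t"
      using ok now t by (simp add: run_ok_def)
    moreover have "Suc (R - S) = Suc R - S" using ok by (auto simp: run_ok_def)
    ultimately show ?thesis using False by simp
  qed
  have "state_ok t (Suc R) 0 t (V j) ((s(i := (0, vzero, False))) j)" if "j \<in> {1..n}" for j
    using run_okD(2)[OF ok that] t by (auto simp: state_ok_def)
  then show ?thesis using ok t u R now lower by (auto simp: run_ok_def)
qed

lemma run_ok: "run_ok (proto_time A V g \<omega> k) (protocol A V g \<omega> k) (track \<omega> k)"
proof (induction k)
  case 0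
  show ?case
    by (auto simp: run_ok_def proto_time_def init_state_def state_ok_def zero_ereal_def)
next
  case (Suc k)
  obtain s gs where P: "protocol A V g \<omega> k = (s, gs)" by force
  obtain R S N \<tau> where Q: "track \<omega> k = (R, S, N, \<tau>)" by (metis prod_cases4)
  obtain t i c x where q: "A gs = (t, i, c, x)" by (metis prod_cases4)
  obtain st sx sq where si: "s i = (st, sx, sq)" by (metis prod_cases3)
  define now where "now = proto_time A V g \<omega> k"
  have ok: "run_ok now (s, gs) (R, S, N, \<tau>)" using Suc P Q by (simp add: now_def)
  have gs: "set gs \<subseteq> Rd T" "\<forall>u\<in>set gs. \<forall>j>R. u j = 0" using ok by (auto simp: run_ok_def)
  note qf = query_facts[OF gs(1) q]
  have t': "proto_time A V g \<omega> (Suc k) = t" using P q by (simp add: proto_time_def)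
  have t: "now \<le> t"
  proof (cases k)
    case 0
    then show ?thesis using qf(1) by (simp add: now_def proto_time_def)
  next
    case (Suc l)
    obtain s1 gs1 where P1: "protocol A V g \<omega> l = (s1, gs1)" by force
    have "gs \<noteq> [] \<and> butlast gs = gs1"
      using P unfolding Suc by (auto simp: P1 split: prod.splits)
    then show ?thesis using qf(5) unfolding now_def Suc proto_time_def
      by (cases "A gs1") (simp add: P1)
  qed
  have now: "0 \<le> \<tau>" "\<tau> \<le> now" "0 \<le> now" using ok by (auto simp: run_ok_def)
  have so: "state_ok now R (N i) \<tau> (V i) (st, sx, sq)" and Ni: "real (N i) \<le> V i now - V i \<tau>"
    using run_okD[OF ok qf(2)] si by simp_all
  have zero: "vzero \<in> Rd T" "\<forall>j>R. vzero j = 0" by (auto simp: Rd_def vzero_def)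
  have use: "useful \<omega> k R \<longleftrightarrow> \<not> c \<and> sq \<and> 1 \<le> V i t - V i st \<and> R < T \<and> (R = 0 \<or> sx R \<noteq> 0)"
    using P q si by (simp add: useful_def)
  note unf = t' protocol.simps track.simps P Q q si Let_def prod.case snd_conv oracle_call.simps
  consider "c" | "\<not> c" "\<not> sq" | "\<not> c" "sq" "V i t - V i st < 1" | "\<not> c" "sq" "1 \<le> V i t - V i st"
    by linarith
  then show ?case
  proof cases
    case 1
    then show ?thesis
      using run_ok_quiet[OF ok t qf(2) state_ok_idle zero] use unfolding unf by simp
  next
    case 2
    have "state_ok t R (N i) \<tau> (V i) (t, x, True)"
      using qf gs(2) now t Ni V_le[OF qf(2) now(3) t] by (auto simp: state_ok_def)
    then show ?thesis
      using run_ok_quiet[OF ok t qf(2) _ zero] use 2 unfolding unf by simp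
  next
    case 3
    then show ?thesis
      using run_ok_quiet[OF ok t qf(2) state_ok_later[OF so t] zero] use unfolding unf by simp
  next
    case 4
    let ?u = "g i sx (\<omega> k) t"
    have sx: "sx \<in> Rd T" "\<forall>j>R. sx j = 0" using so 4 by (auto simp: state_ok_def)
    have u: "?u \<in> Rd T" using g_Rd sx by blast
    show ?thesis
    proof (cases "useful \<omega> k R")
      case False
      have "\<forall>j>R. ?u j = 0"
      proof (cases "R < T")
        case True
        then have R: "R \<noteq> 0" "sx R = 0" using False use 4 by auto
        have "\<forall>j>R - 1. sx j = 0"
        proof (intro allI impI)
          fix j assume "R - 1 < j"
          then show "sx j = 0" using sx R by (cases "j = R") auto
        qed
        then show ?thesis using g_chain[OF sx(1), of "R - 1"] R by simp
      next
        case False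
        then show ?thesis using u by (auto simp: Rd_def)
      qed
      then show ?thesis
        using run_ok_quiet[OF ok t qf(2) state_ok_idle u] 4 False unfolding unf by simp
    next
      case True
      then have R: "R < T" "R = 0 \<or> sx R \<noteq> 0" using use by auto
      have "\<tau> \<le> st" "real (N i) \<le> V i st - V i \<tau>" using so 4 R by (auto simp: state_ok_def)
      then have st: "real (Suc (N i)) \<le> V i t - V i \<tau>" using 4 by simp
      show ?thesis
      proof (cases "\<omega> k = 0")
        case miss: True
        have "\<forall>j>R. ?u j = 0" using g_silent[OF sx] miss by simp
        then show ?thesis
          using run_ok_miss[OF ok t qf(2) st u] 4 True miss unfolding unf by simp
      next
        case hit: False
        have "\<forall>j>Suc R. ?u j = 0" using g_chain[OF sx] by simp
        then show ?thesis
          using run_ok_hit[OF ok t qf(2) st u _ R(1)] 4 True hit unfolding unf by simp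
      qed
    qed
  qed
qed

lemma lower_time_mono: "j \<le> k \<Longrightarrow> lower_time n V m j \<le> lower_time n V m k"
  by (rule lift_Suc_mono_le[of "lower_time n V m"]) (use lower_time_le_Suc(1)[OF V_mono V_cont m_pos] in auto)

lemma lower_time_le_time:
  assumes "K + lucky \<omega> k \<le> reveals \<omega> k"
  shows "lower_time n V m K \<le> ereal (proto_time A V g \<omega> k)"
proof -
  obtain R S N \<tau> where Q: "track \<omega> k = (R, S, N, \<tau>)" by (metis prod_cases4)
  obtain s gs where P: "protocol A V g \<omega> k = (s, gs)" by force
  have "lower_time n V m K \<le> lower_time n V m (R - S)"
    using assms by (intro lower_time_mono) (simp add: reveals_def lucky_def Q)
  also have "\<dots> \<le> ereal \<tau>" using run_ok[of \<omega> k] by (simp add: run_ok_def P Q)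
  also have "\<dots> \<le> ereal (proto_time A V g \<omega> k)" using run_ok[of \<omega> k] by (simp add: run_ok_def P Q)
  finally show ?thesis .
qed

lemma reveals_le: "reveals \<omega> k \<le> T"
  using run_ok[of \<omega> k] by (auto simp: run_ok_def reveals_def split: prod.splits)

lemma point_facts:
  shows "proto_point A V g \<omega> k \<in> Rd T"
    and "j > reveals \<omega> k \<Longrightarrow> proto_point A V g \<omega> k j = 0"
proof -
  obtain s gs where P: "protocol A V g \<omega> k = (s, gs)" by force
  obtain t i c x where q: "A gs = (t, i, c, x)" by (metis prod_cases4)
  have gs: "set gs \<subseteq> Rd T" "\<forall>u\<in>set gs. \<forall>j>reveals \<omega> k. u j = 0"
    using run_ok[of \<omega> k] by (auto simp: P run_ok_def reveals_def split: prod.splits)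
  show "proto_point A V g \<omega> k \<in> Rd T" "j > reveals \<omega> k \<Longrightarrow> proto_point A V g \<omega> k j = 0"
    using query_facts(3)[OF gs(1) q] query_facts(4)[OF gs(1) q gs(2)] by (auto simp: proto_point_def P q)
qed

lemma lucky_Suc:
  "lucky \<omega> (Suc k) = lucky \<omega> k + (if early_try \<omega> k \<and> \<omega> k \<noteq> 0 then 1 else 0)"
  by (auto simp: lucky_def early_try_def Let_def split: prod.splits)

text \<open>
  In each of the at most \<open>T + 1\<close> stages, only the first \<open>M - 1\<close> useful gradients are early.
\<close>

lemma early_tries_le: "(\<Sum>l<k. of_bool (early_try \<omega> l)) \<le> (M - 1) * (T + 1)"
proof -
  have "(\<Sum>l<k. of_bool (early_try \<omega> l)) \<le>
      (M - 1) * reveals \<omega> k + min (M - 1) (\<Sum>i=1..n. fst (snd (snd (track \<omega> k))) i)"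
  proof (induction k)
    case (Suc k)
    obtain R S N \<tau> where Q: "track \<omega> k = (R, S, N, \<tau>)" by (metis prod_cases4)
    obtain s gs where P: "protocol A V g \<omega> k = (s, gs)" by force
    obtain t i c x where q: "A gs = (t, i, c, x)" by (metis prod_cases4)
    have i: "i \<in> {1..n}" using run_ok[of \<omega> k] query_facts(2)[OF _ q] by (auto simp: run_ok_def P Q)
    have N: "(\<Sum>j=1..n. (N(i := Suc (N i))) j) = Suc (\<Sum>j=1..n. N j)"
    proof -
      have "(\<Sum>j=1..n. (N(i := Suc (N i))) j) = (\<Sum>j=1..n. N j + of_bool (j = i))"
        by (intro sum.cong) auto
      then show ?thesis using i by (simp add: sum.distrib)
    qed
    have "(\<Sum>l<k. of_bool (early_try \<omega> l)) \<le> (M - 1) * R + min (M - 1) (\<Sum>i=1..n. N i)"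
      using Suc by (simp add: Q reveals_def)
    then show ?case
      using N by (auto simp: Q P q reveals_def early_try_def Let_def simp del: fun_upd_apply)
  qed (simp add: reveals_def)
  also have "\<dots> \<le> (M - 1) * T + (M - 1)"
    using reveals_le[of \<omega> k] by (intro add_mono mult_le_mono) auto
  finally show ?thesis by simp
qed

lemma useful_cong: "\<forall>j<k. \<omega> j = \<omega>' j \<Longrightarrow> useful \<omega> k r = useful \<omega>' k r"
  using protocol_cong[of k \<omega> \<omega>' A V g] by (simp add: useful_def)

lemma track_cong: "\<forall>j<k. \<omega> j = \<omega>' j \<Longrightarrow> track \<omega> k = track \<omega>' k"
proof (induction k)
  case (Suc k)
  then show ?case
    using protocol_cong[of k \<omega> \<omega>' A V g] useful_cong[of k \<omega> \<omega>'] by (simp add: Let_def split: prod.splits)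
qed simp

lemma early_try_cong: "\<forall>j<k. \<omega> j = \<omega>' j \<Longrightarrow> early_try \<omega> k = early_try \<omega>' k"
  using track_cong[of k \<omega> \<omega>'] useful_cong[of k \<omega> \<omega>'] by (simp add: early_try_def split: prod.splits)

lemma lucky_eq_sum:
  "lucky \<omega> k = (\<Sum>l<k. of_bool (early_try \<omega> l \<and> \<omega> l \<noteq> 0))"
  by (induction k) (simp_all add: lucky_Suc, simp add: lucky_def)

text \<open>
  Outside an event of probability at most one half, at most \<open>T - K\<close> reveals are lucky, so that \<open>T\<close>
  reveals include \<open>K\<close> that are not and therefore take at least the \<open>K\<close>th lower time. This time is
  positive, so if it is finite then its half is strictly smaller, and if it is infinite then no step
  reaches it.
\<close>

lemma expected_gradient_ge:
  assumes p: "0 \<le> p" "p \<le> 1" and K: "1 \<le> K" "2 * K \<le> T + 1"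
    and pM: "p * real (M - 1) \<le> 1 / 4"
    and b: "0 \<le> b" "\<And>x. x \<in> Rd T \<Longrightarrow> x T = 0 \<Longrightarrow> b \<le> (vnorm T (G x))\<^sup>2"
  shows "b / 2 \<le> (\<integral>\<omega>. (INF k \<in> {k. ereal (proto_time A V g \<omega> k) \<le> lower_time n V m K / 2}.
      (vnorm T (G (proto_point A V g \<omega> k)))\<^sup>2) \<partial>coins p)"
proof -
  define a where "a = T + 1 - K"
  have a: "a > 0" "T + 1 \<le> 2 * a" using K by (auto simp: a_def)
  define U where "U = {\<omega> \<in> space (coins p). \<exists>k. real a \<le> (\<Sum>l<k. of_bool (early_try \<omega> l \<and> \<omega> l \<noteq> 0))}"
  have det: "determined_by l (\<lambda>\<omega>. early_try \<omega> l)" for l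
    using early_try_cong by (auto simp: determined_by_def)
  have a0: "0 < real a" using a by simp
  note count = coins_success_count[where E = "\<lambda>l \<omega>. early_try \<omega> l" and C = "(M - 1) * (T + 1)", OF p a0 det early_tries_le,
      folded U_def]
  have "measure (coins p) U \<le> p * real ((M - 1) * (T + 1)) / real a" by (rule count(2))
  also have "\<dots> = (p * real (M - 1)) * (real (T + 1) / real a)"
    by (simp only: of_nat_mult mult.assoc times_divide_eq_right)
  also have "\<dots> \<le> 1 / 4 * 2"
  proof (rule mult_mono[OF pM])
    have "real (T + 1) \<le> 2 * real a" using a(2) by linarith
    then show "real (T + 1) / real a \<le> 2" using a by (simp add: field_simps)
  qed auto
  finally have U: "U \<in> sets (coins p)" "measure (coins p) U \<le> 1 / 2" using count(1) by auto
  obtain K' where K': "K = Suc K'" using K by (cases K) auto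
  have pos: "0 < lower_time n V m K"
    unfolding K' by (rule lower_time_le_Suc(2)[OF V_mono V_cont m_pos])
  show ?thesis
  proof (rule coins_expectation_INF_ge[OF _ _ _ _ U b(1)])
    show "determined_by k (\<lambda>\<omega>. proto_time A V g \<omega> k)" for k
      using proto_time_cong by (auto simp: determined_by_def)
    show "determined_by k (\<lambda>\<omega>. (vnorm T (G (proto_point A V g \<omega> k)))\<^sup>2)" for k
      unfolding determined_by_def using proto_point_cong by metis
    show "ereal (proto_time A V g \<omega> 0) \<le> lower_time n V m K / 2" for \<omega>
      using pos by (cases "lower_time n V m K") (auto simp: proto_time_def)
    fix \<omega> k assume \<omega>: "\<omega> \<in> space (coins p)" "\<omega> \<notin> U"
      and time: "ereal (proto_time A V g \<omega> k) \<le> lower_time n V m K / 2"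
    have "\<not> lower_time n V m K \<le> ereal (proto_time A V g \<omega> k)"
      using time pos by (cases "lower_time n V m K") auto
    then have "reveals \<omega> k < K + lucky \<omega> k"
      using lower_time_le_time[of K \<omega> k] by linarith
    moreover have "lucky \<omega> k < a"
    proof -
      have "(\<Sum>l<k. of_bool (early_try \<omega> l \<and> \<omega> l \<noteq> 0)) < real a" using \<omega> by (auto simp: U_def not_le)
      moreover have "(\<Sum>l<k. of_bool (early_try \<omega> l \<and> \<omega> l \<noteq> 0)) = real (lucky \<omega> k)"
        unfolding lucky_eq_sum by simp
      ultimately show ?thesis by simp
    qed
    ultimately have "reveals \<omega> k < T" using K by (simp add: a_def)
    then show "b \<le> (vnorm T (G (proto_point A V g \<omega> k)))\<^sup>2"
      by (intro b(2) point_facts)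
  qed simp
qed

end

section \<open>The scaled instance and its oracle\<close>

text \<open>
  The parameter \<open>\<kappa>\<close> scales the gradient and \<open>\<rho>\<close> scales the coordinates.
\<close>

definition hard_fun :: "nat \<Rightarrow> real \<Rightarrow> real \<Rightarrow> vec \<Rightarrow> real" where
  "hard_fun T \<kappa> \<rho> x = \<kappa> * \<rho> * chain T (\<lambda>j. x j / \<rho>)"

definition hard_grad :: "nat \<Rightarrow> real \<Rightarrow> real \<Rightarrow> vec \<Rightarrow> vec" where
  "hard_grad T \<kappa> \<rho> x = (\<lambda>j. \<kappa> * chain_grad T (\<lambda>j. x j / \<rho>) j)"

text \<open>
  A coordinate is hidden if it and all later ones vanish at \<open>x\<close>; the hidden part of the gradient is
  shown with probability \<open>p\<close>, and then amplified so that the mean is correct.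
\<close>

definition coin_grad :: "nat \<Rightarrow> real \<Rightarrow> real \<Rightarrow> real \<Rightarrow> nat \<Rightarrow> vec \<Rightarrow> real \<Rightarrow> real \<Rightarrow> vec" where
  "coin_grad T \<kappa> \<rho> p i x \<xi> t = (\<lambda>j. (if \<forall>l\<ge>j. x l = 0 then \<xi> / p else 1) * hard_grad T \<kappa> \<rho> x j)"

lemma hard_grad_Rd: "hard_grad T \<kappa> \<rho> x \<in> Rd T"
  by (auto simp: Rd_def hard_grad_def chain_grad_def)

lemma hard_fun_smooth:
  assumes "\<kappa> > 0" "\<rho> > 0"
  shows "smooth_fun T (6 * \<kappa> / \<rho>) (hard_fun T \<kappa> \<rho>) (hard_grad T \<kappa> \<rho>)"
  unfolding smooth_fun_def
proof (intro conjI ballI)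
  fix x :: vec
  let ?y = "\<lambda>j. x j / \<rho>"
  show "has_gradient T (hard_fun T \<kappa> \<rho>) (hard_grad T \<kappa> \<rho> x) x"
    unfolding has_gradient_def
  proof (intro conjI allI impI hard_grad_Rd)
    fix e :: real assume "e > 0"
    then have "e / \<kappa> > 0" using assms by simp
    then obtain \<delta> where \<delta>: "\<delta> > 0" "\<And>h. h \<in> Rd T \<Longrightarrow> vnorm T h < \<delta> \<Longrightarrow>
        \<bar>chain T (\<lambda>j. ?y j + h j) - chain T ?y - (\<Sum>j=1..T. chain_grad T ?y j * h j)\<bar> \<le> e / \<kappa> * vnorm T h"
      using chain_has_gradient[of T ?y] unfolding has_gradient_def by blast
    show "\<exists>\<delta>>0. \<forall>h\<in>Rd T. vnorm T h < \<delta> \<longrightarrow>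
        \<bar>hard_fun T \<kappa> \<rho> (\<lambda>j. x j + h j) - hard_fun T \<kappa> \<rho> x - (\<Sum>j=1..T. hard_grad T \<kappa> \<rho> x j * h j)\<bar> \<le> e * vnorm T h"
    proof (intro exI[of _ "\<rho> * \<delta>"] conjI ballI impI)
      fix h assume h: "h \<in> Rd T" "vnorm T h < \<rho> * \<delta>"
      let ?h = "\<lambda>j. h j / \<rho>"
      have nh: "vnorm T ?h = vnorm T h / \<rho>"
        using vnorm_mult[of T "1 / \<rho>" h] assms by simp
      have h': "?h \<in> Rd T" "vnorm T ?h < \<delta>"
        using h assms unfolding nh by (auto simp: Rd_def divide_less_eq mult.commute)
      have "hard_fun T \<kappa> \<rho> (\<lambda>j. x j + h j) - hard_fun T \<kappa> \<rho> x - (\<Sum>j=1..T. hard_grad T \<kappa> \<rho> x j * h j) =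
          \<kappa> * \<rho> * (chain T (\<lambda>j. ?y j + ?h j) - chain T ?y - (\<Sum>j=1..T. chain_grad T ?y j * ?h j))"
        using assms by (simp add: hard_fun_def hard_grad_def right_diff_distrib sum_distrib_left add_divide_distrib)
          (auto intro!: sum.cong simp: field_simps)
      also have "\<bar>\<dots>\<bar> \<le> \<kappa> * \<rho> * (e / \<kappa> * vnorm T ?h)"
        unfolding abs_mult using assms by (intro mult_mono \<delta> h') auto
      also have "\<dots> = e * vnorm T h" using assms by (simp add: nh)
      finally show "\<bar>hard_fun T \<kappa> \<rho> (\<lambda>j. x j + h j) - hard_fun T \<kappa> \<rho> x - (\<Sum>j=1..T. hard_grad T \<kappa> \<rho> x j * h j)\<bar> \<le> e * vnorm T h" .
    qed (use assms \<delta> in simp)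
  qed
next
  fix x y assume "x \<in> Rd T" "y \<in> Rd T"
  then have xy: "(\<lambda>j. x j / \<rho>) \<in> Rd T" "(\<lambda>j. y j / \<rho>) \<in> Rd T" by (auto simp: Rd_def)
  have "vnorm T (\<lambda>j. hard_grad T \<kappa> \<rho> x j - hard_grad T \<kappa> \<rho> y j) =
      \<kappa> * vnorm T (\<lambda>j. chain_grad T (\<lambda>j. x j / \<rho>) j - chain_grad T (\<lambda>j. y j / \<rho>) j)"
    using assms vnorm_mult[of T \<kappa>] by (simp add: hard_grad_def flip: right_diff_distrib)
  also have "\<dots> \<le> \<kappa> * (6 * vnorm T (\<lambda>j. x j / \<rho> - y j / \<rho>))"
    using assms by (intro mult_left_mono chain_grad_lipschitz xy) auto
  also have "vnorm T (\<lambda>j. x j / \<rho> - y j / \<rho>) = vnorm T (\<lambda>j. x j - y j) / \<rho>"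
    using vnorm_mult[of T "1 / \<rho>" "\<lambda>j. x j - y j"] assms by (simp add: diff_divide_distrib)
  finally show "vnorm T (\<lambda>j. hard_grad T \<kappa> \<rho> x j - hard_grad T \<kappa> \<rho> y j) \<le> 6 * \<kappa> / \<rho> * vnorm T (\<lambda>j. x j - y j)"
    by (simp add: mult.left_commute mult.assoc)
qed

lemma hard_fun_gap:
  assumes "\<kappa> > 0" "\<rho> > 0"
  shows "- (\<kappa> * \<rho> * real T) \<le> hard_fun T \<kappa> \<rho> x" "hard_fun T \<kappa> \<rho> vzero \<le> 0"
proof -
  show "- (\<kappa> * \<rho> * real T) \<le> hard_fun T \<kappa> \<rho> x"
    using mult_left_mono[OF chain_ge[of T "\<lambda>j. x j / \<rho>"], of "\<kappa> * \<rho>"] assms by (simp add: hard_fun_def)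
  have "(\<lambda>j. vzero j / \<rho>) = vzero" by (simp add: vzero_def)
  then show "hard_fun T \<kappa> \<rho> vzero \<le> 0"
    using mult_left_mono[OF chain_vzero_le[of T], of "\<kappa> * \<rho>"] assms by (simp add: hard_fun_def)
qed

lemma hard_grad_large:
  assumes "\<kappa> > 0" "T \<ge> 1" "x T = 0"
  shows "\<kappa>\<^sup>2 / 256 \<le> (vnorm T (hard_grad T \<kappa> \<rho> x))\<^sup>2"
proof -
  have "\<kappa>\<^sup>2 * (1 / 16)\<^sup>2 \<le> \<kappa>\<^sup>2 * (vnorm T (chain_grad T (\<lambda>j. x j / \<rho>)))\<^sup>2"
    using assms by (intro mult_left_mono chain_grad_large) auto
  then show ?thesis
    by (simp add: hard_grad_def vnorm_mult power_mult_distrib power_divide)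
qed

lemma hard_grad_zero:
  assumes "\<rho> > 0" "\<forall>l\<ge>j. x l = 0" "j \<ge> 2" "x (j - 1) = 0"
  shows "hard_grad T \<kappa> \<rho> x j = 0"
  using chain_grad_zero[of j "\<lambda>j. x j / \<rho>" T] assms by (simp add: hard_grad_def)

text \<open>
  By the zero-chain property at most one hidden coordinate of the gradient is nonzero.
\<close>

lemma hard_grad_hidden_sum:
  assumes "\<kappa> > 0" "\<rho> > 0"
  shows "(\<Sum>j | j \<in> {1..T} \<and> (\<forall>l\<ge>j. x l = 0). (hard_grad T \<kappa> \<rho> x j)\<^sup>2) \<le> \<kappa>\<^sup>2"
proof -
  let ?H = "{j. j \<in> {1..T} \<and> (\<forall>l\<ge>j. x l = 0)}"
  have fin: "finite ?H" by (rule finite_subset[of _ "{1..T}"]) auto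
  show ?thesis
  proof (cases "\<exists>j\<in>?H. hard_grad T \<kappa> \<rho> x j \<noteq> 0")
    case True
    then obtain j where j: "j \<in> ?H" "hard_grad T \<kappa> \<rho> x j \<noteq> 0" by blast
    have "hard_grad T \<kappa> \<rho> x i = 0" if i: "i \<in> ?H" "i \<noteq> j" for i
    proof (cases "j < i")
      case True
      then show ?thesis using i j assms by (intro hard_grad_zero) auto
    next
      case False
      then have "i < j" using i by simp
      then have "hard_grad T \<kappa> \<rho> x j = 0" using i j assms by (intro hard_grad_zero) auto
      then show ?thesis using j by simp
    qed
    then have "(\<Sum>j\<in>?H. (hard_grad T \<kappa> \<rho> x j)\<^sup>2) = (\<Sum>j\<in>{j}. (hard_grad T \<kappa> \<rho> x j)\<^sup>2)"
      using j fin by (intro sum.mono_neutral_right) auto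
    also have "\<dots> \<le> \<kappa>\<^sup>2"
    proof -
      have "\<bar>chain_grad T (\<lambda>j. x j / \<rho>) j\<bar> \<le> 1" using j by (intro chain_grad_hidden) auto
      then have "\<bar>hard_grad T \<kappa> \<rho> x j\<bar> \<le> \<bar>\<kappa>\<bar>"
        using mult_left_mono[of _ 1 "\<bar>\<kappa>\<bar>"] by (simp add: hard_grad_def abs_mult)
      then show ?thesis by (simp add: abs_le_square_iff)
    qed
    finally show ?thesis .
  qed (auto intro!: sum_nonpos[THEN order_trans])
qed

lemma coin_grad_stochastic:
  assumes \<kappa>: "\<kappa> > 0" "\<rho> > 0" and p: "0 < p" "p \<le> 1" and var: "\<kappa>\<^sup>2 * ((1 - p) / p) \<le> \<sigma>sq"
  shows "stochastic_gradients T n (hard_grad T \<kappa> \<rho>) \<sigma>sq (coin p) (\<lambda>_ _ _. coin p) (coin_grad T \<kappa> \<rho> p)"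
  unfolding stochastic_gradients_def
proof (intro ballI allI impI conjI prob_space_coin refl integrable_coin)
  fix x i and t :: real assume x: "x \<in> Rd T"
  show "coin_grad T \<kappa> \<rho> p i x \<xi> t \<in> Rd T" for \<xi>
    using hard_grad_Rd[of T \<kappa> \<rho> x] by (auto simp: Rd_def coin_grad_def)
  show "(\<integral>\<xi>. coin_grad T \<kappa> \<rho> p i x \<xi> t j \<partial>coin p) = hard_grad T \<kappa> \<rho> x j" for j
    using p by (cases "\<forall>l\<ge>j. x l = 0") (simp_all only: integral_coin coin_grad_def, simp_all add: algebra_simps)
  let ?H = "{j. j \<in> {1..T} \<and> (\<forall>l\<ge>j. x l = 0)}"
  define W where "W = (\<Sum>j\<in>?H. (hard_grad T \<kappa> \<rho> x j)\<^sup>2)"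
  have v: "(vnorm T (\<lambda>j. coin_grad T \<kappa> \<rho> p i x \<xi> t j - hard_grad T \<kappa> \<rho> x j))\<^sup>2 = (\<xi> / p - 1)\<^sup>2 * W" for \<xi>
  proof -
    have "(vnorm T (\<lambda>j. coin_grad T \<kappa> \<rho> p i x \<xi> t j - hard_grad T \<kappa> \<rho> x j))\<^sup>2 =
        (\<Sum>j\<in>{1..T}. if \<forall>l\<ge>j. x l = 0 then (\<xi> / p - 1)\<^sup>2 * (hard_grad T \<kappa> \<rho> x j)\<^sup>2 else 0)"
      unfolding vnorm_sq
      by (intro sum.cong) (auto simp: coin_grad_def left_diff_distrib power_mult_distrib[symmetric])
    also have "\<dots> = (\<xi> / p - 1)\<^sup>2 * W"
      unfolding W_def sum_distrib_left by (subst sum.inter_filter[symmetric]) (auto simp: Collect_conj_eq)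
    finally show ?thesis .
  qed
  have "(\<integral>\<xi>. (vnorm T (\<lambda>j. coin_grad T \<kappa> \<rho> p i x \<xi> t j - hard_grad T \<kappa> \<rho> x j))\<^sup>2 \<partial>coin p) =
      W * ((1 / p - 1)\<^sup>2 * p + (1 - p))"
    unfolding v using p by (simp add: integral_coin algebra_simps)
  also have "(1 / p - 1)\<^sup>2 * p + (1 - p) = (1 - p) / p"
    using p by (simp add: field_simps power2_eq_square)
  also have "W * ((1 - p) / p) \<le> \<kappa>\<^sup>2 * ((1 - p) / p)"
    unfolding W_def using p \<kappa> by (intro mult_right_mono hard_grad_hidden_sum) auto
  finally show "(\<integral>\<xi>. (vnorm T (\<lambda>j. coin_grad T \<kappa> \<rho> p i x \<xi> t j - hard_grad T \<kappa> \<rho> x j))\<^sup>2 \<partial>coin p) \<le> \<sigma>sq"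
    using var by linarith
qed

lemma coin_grad_chain_run:
  assumes "zero_respecting T n A" "\<And>i. i \<in> {1..n} \<Longrightarrow> computation_power (v i)"
    and "\<rho> > 0" "0 < m" "m \<le> real M"
  shows "chain_run A (\<lambda>i. cum_power (v i)) (coin_grad T \<kappa> \<rho> p) n T M m"
proof
  show "coin_grad T \<kappa> \<rho> p i x \<xi> t \<in> Rd T" for i x \<xi> t
    using hard_grad_Rd[of T \<kappa> \<rho> x] by (auto simp: Rd_def coin_grad_def)
  show "coin_grad T \<kappa> \<rho> p i x \<xi> t j = 0" if "\<forall>j>r. x j = 0" "Suc r < j" for i x \<xi> t r j
  proof -
    have "hard_grad T \<kappa> \<rho> x j = 0" using that assms by (intro hard_grad_zero) auto
    then show ?thesis by (simp add: coin_grad_def)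
  qed
  show "coin_grad T \<kappa> \<rho> p i x 0 t j = 0" if "\<forall>j>r. x j = 0" "r < j" for i x t r j
    using that by (auto simp: coin_grad_def)
qed (use assms cum_power_mono cum_power_continuous in auto)

section \<open>The lower bound\<close>

theorem theorem5p1:
  shows "\<exists>c' c1 c2 :: real. c' > 0 \<and> c1 > 0 \<and> c2 > 0 \<and>
    (\<forall>(n::nat) (v :: nat \<Rightarrow> real \<Rightarrow> real) (L::real) (\<Delta>::real) (\<epsilon>::real) (\<sigma>sq::real).
       n \<ge> 1 \<longrightarrow> (\<forall>i\<in>{1..n}. computation_power (v i)) \<longrightarrow>
       L > 0 \<longrightarrow> \<Delta> > 0 \<longrightarrow> \<epsilon> > 0 \<longrightarrow> \<sigma>sq \<ge> 0 \<longrightarrow> \<epsilon> < c' * L * \<Delta> \<longrightarrow>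
       (let V = (\<lambda>i. cum_power (v i)) in \<exists>d\<ge>1. \<forall>A. zero_respecting d n A \<longrightarrow>
          (\<exists>(f :: vec \<Rightarrow> real) (f' :: vec \<Rightarrow> vec) (S :: real measure)
             (D :: vec \<Rightarrow> real \<Rightarrow> nat \<Rightarrow> real measure)
             (g :: nat \<Rightarrow> vec \<Rightarrow> real \<Rightarrow> real \<Rightarrow> vec).
             smooth_fun d L f f' \<and>
             (\<exists>fstar. (\<forall>x\<in>Rd d. f x \<ge> fstar) \<and> f vzero - fstar \<le> \<Delta>) \<and>
             stochastic_gradients d n f' \<sigma>sq S D g \<and>
             Ionescu_Tulcea (sample_kernel A V g D) (\<lambda>_. S) \<and>
             (let t = lower_time n V (c2 * real_of_int (max \<lceil>\<sigma>sq / \<epsilon>\<rceil> 1)) (nat \<lfloor>c1 * L * \<Delta> / \<epsilon>\<rfloor>) / 2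
              in (\<integral>\<omega>. (INF k \<in> {k. ereal (proto_time A V g \<omega> k) \<le> t}.
                         (vnorm d (f' (proto_point A V g \<omega> k)))\<^sup>2)
                   \<partial>sample_law A V g S D) > \<epsilon>))))"
proof (rule exI[of _ "1/12288"], rule exI[of _ "1/12288"], rule exI[of _ "1/4096"], intro conjI allI impI)
  fix n :: nat and v :: "nat \<Rightarrow> real \<Rightarrow> real" and L \<Delta> \<epsilon> \<sigma>sq :: real
  assume n: "n \<ge> 1" and v: "\<forall>i\<in>{1..n}. computation_power (v i)"
    and pos: "L > 0" "\<Delta> > 0" "\<epsilon> > 0" "\<sigma>sq \<ge> 0" and small: "\<epsilon> < 1/12288 * L * \<Delta>"
  \<comment> \<open>At points with last coordinate zero the squared gradient is at least \<open>\<kappa>\<^sup>2 / 256 = 4 \<epsilon>\<close>. Half of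
    the probability then leaves \<open>2 \<epsilon>\<close> for the expectation.\<close>
  define \<kappa> where "\<kappa> = 32 * sqrt \<epsilon>"
  \<comment> \<open>The solution of \<open>6 \<kappa> / \<rho> = L\<close>, where \<open>6\<close> is the smoothness constant of the chain.\<close>
  define \<rho> where "\<rho> = 192 * sqrt \<epsilon> / L"
  \<comment> \<open>A chain of length \<open>T\<close> has gap at most \<open>\<kappa> \<rho> T = 6144 (\<epsilon> / L) T\<close>, which must not exceed \<open>\<Delta>\<close>. The
    constant \<open>12288\<close> is twice \<open>6144\<close>, because about half of the reveals may be lucky.\<close>
  define y where "y = L * \<Delta> / (6144 * \<epsilon>)"
  define T where "T = nat \<lfloor>y\<rfloor>"
  define K where "K = nat \<lfloor>1/12288 * L * \<Delta> / \<epsilon>\<rfloor>"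
  \<comment> \<open>The solution of \<open>\<kappa>\<^sup>2 (1 - p) / p = \<sigma>\<^sup>2\<close>, the variance condition of \<open>coin_grad_stochastic\<close>.\<close>
  define p where "p = 1024 * \<epsilon> / (\<sigma>sq + 1024 * \<epsilon>)"
  \<comment> \<open>The factor \<open>1 / 4096 = 1 / (4 \<cdot> 1024)\<close> gives \<open>p (M - 1) \<le> 1 / 4\<close>.\<close>
  define m where "m = 1/4096 * real_of_int (max \<lceil>\<sigma>sq / \<epsilon>\<rceil> 1)"
  define M where "M = nat \<lceil>m\<rceil>"
  have \<kappa>: "\<kappa> > 0" "\<kappa>\<^sup>2 = 1024 * \<epsilon>" using pos by (simp_all add: \<kappa>_def power_mult_distrib)
  have \<rho>: "\<rho> > 0" "6 * \<kappa> / \<rho> = L" using pos by (simp_all add: \<rho>_def \<kappa>_def)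
  have "\<kappa> * \<rho> = 6144 * \<epsilon> / L" using pos by (simp add: \<kappa>_def \<rho>_def)
  have y2: "y > 2" using small pos by (simp add: y_def field_simps)
  have T: "real T \<le> y" "y < real T + 1" "T \<ge> 1"
    using y2 unfolding T_def by linarith+
  have gap: "\<kappa> * \<rho> * real T \<le> \<Delta>"
  proof -
    have "\<kappa> * \<rho> * real T \<le> 6144 * \<epsilon> / L * y"
      unfolding \<open>\<kappa> * \<rho> = _\<close> using T pos by (intro mult_left_mono) auto
    also have "\<dots> = \<Delta>" using pos by (simp add: y_def)
    finally show ?thesis .
  qed
  have Ky: "1/12288 * L * \<Delta> / \<epsilon> = y / 2" by (simp add: y_def)
  have K: "1 \<le> K" "2 * K \<le> T + 1"
    unfolding K_def Ky T_def using y2 by linarith+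
  have den: "\<sigma>sq + 1024 * \<epsilon> > 0" using pos by simp
  have p: "0 < p" "p \<le> 1" using pos den by (simp_all add: p_def)
  have "1 - p = \<sigma>sq / (\<sigma>sq + 1024 * \<epsilon>)"
    unfolding p_def using den by (simp add: divide_simps)
  then have "(1 - p) / p = \<sigma>sq / (1024 * \<epsilon>)"
    using den by (simp add: p_def)
  then have var: "\<kappa>\<^sup>2 * ((1 - p) / p) \<le> \<sigma>sq" using pos \<kappa> by simp
  have m: "0 < m" "m \<le> real M" unfolding M_def m_def by linarith+
  have pM: "p * real (M - 1) \<le> 1 / 4"
  proof -
    have "real_of_int (max \<lceil>\<sigma>sq / \<epsilon>\<rceil> 1) \<le> \<sigma>sq / \<epsilon> + 1"
      using pos by (simp add: max_def)
    then have "m \<le> 1/4096 * (\<sigma>sq / \<epsilon> + 1)" by (simp add: m_def)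
    moreover have "real (M - 1) \<le> m" using m unfolding M_def by linarith
    ultimately have "real (M - 1) \<le> 1/4096 * (\<sigma>sq / \<epsilon> + 1)" by linarith
    then have "p * real (M - 1) \<le> p * (1/4096 * (\<sigma>sq / \<epsilon> + 1))"
      using p by (intro mult_left_mono) auto
    also have "\<dots> = 1/4 * ((\<sigma>sq + \<epsilon>) / (\<sigma>sq + 1024 * \<epsilon>))"
    proof -
      have "\<sigma>sq / \<epsilon> + 1 = (\<sigma>sq + \<epsilon>) / \<epsilon>" using pos by (simp add: add_divide_distrib)
      moreover have "1024 * \<epsilon> / q * (1/4096 * (z / \<epsilon>)) = 1/4 * (z / q)" for q z using pos by simp
      ultimately show ?thesis by (simp only: p_def)
    qed
    also have "\<dots> \<le> 1/4 * 1"
      using pos den by (intro mult_left_mono) (auto simp: divide_le_eq_1)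
    finally show ?thesis by simp
  qed
  have main: "\<exists>(f :: vec \<Rightarrow> real) (f' :: vec \<Rightarrow> vec) (S :: real measure)
      (D :: vec \<Rightarrow> real \<Rightarrow> nat \<Rightarrow> real measure) (g :: nat \<Rightarrow> vec \<Rightarrow> real \<Rightarrow> real \<Rightarrow> vec).
      smooth_fun T L f f' \<and>
      (\<exists>fstar. (\<forall>x\<in>Rd T. f x \<ge> fstar) \<and> f vzero - fstar \<le> \<Delta>) \<and>
      stochastic_gradients T n f' \<sigma>sq S D g \<and>
      Ionescu_Tulcea (sample_kernel A (\<lambda>i. cum_power (v i)) g D) (\<lambda>_. S) \<and>
      (\<integral>\<omega>. (INF k \<in> {k. ereal (proto_time A (\<lambda>i. cum_power (v i)) g \<omega> k) \<le>
            lower_time n (\<lambda>i. cum_power (v i)) m K / 2}.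
          (vnorm T (f' (proto_point A (\<lambda>i. cum_power (v i)) g \<omega> k)))\<^sup>2)
        \<partial>sample_law A (\<lambda>i. cum_power (v i)) g S D) > \<epsilon>"
    if A: "zero_respecting T n A" for A
  proof -
    let ?g = "coin_grad T \<kappa> \<rho> p"
    interpret chain_run A "\<lambda>i. cum_power (v i)" ?g n T M m
      using A v \<rho> m by (intro coin_grad_chain_run) auto
    have "4 * \<epsilon> \<le> (vnorm T (hard_grad T \<kappa> \<rho> x))\<^sup>2" if "x T = 0" for x
      using hard_grad_large[of \<kappa> T x \<rho>] \<kappa> T that by simp
    then have "4 * \<epsilon> / 2 \<le> (\<integral>\<omega>. (INF k \<in> {k. ereal (proto_time A (\<lambda>i. cum_power (v i)) ?g \<omega> k) \<le>
          lower_time n (\<lambda>i. cum_power (v i)) m K / 2}.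
        (vnorm T (hard_grad T \<kappa> \<rho> (proto_point A (\<lambda>i. cum_power (v i)) ?g \<omega> k)))\<^sup>2) \<partial>coins p)"
      using p K pM pos by (intro expected_gradient_ge) auto
    moreover have "\<epsilon> < 4 * \<epsilon> / 2" using pos by simp
    ultimately have "\<epsilon> < (\<integral>\<omega>. (INF k \<in> {k. ereal (proto_time A (\<lambda>i. cum_power (v i)) ?g \<omega> k) \<le>
          lower_time n (\<lambda>i. cum_power (v i)) m K / 2}.
        (vnorm T (hard_grad T \<kappa> \<rho> (proto_point A (\<lambda>i. cum_power (v i)) ?g \<omega> k)))\<^sup>2) \<partial>coins p)"
      by (rule less_le_trans[rotated])
    moreover have "smooth_fun T L (hard_fun T \<kappa> \<rho>) (hard_grad T \<kappa> \<rho>)"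
      using hard_fun_smooth[of \<kappa> \<rho> T] \<kappa> \<rho> by simp
    moreover have "\<exists>fstar. (\<forall>x\<in>Rd T. hard_fun T \<kappa> \<rho> x \<ge> fstar) \<and> hard_fun T \<kappa> \<rho> vzero - fstar \<le> \<Delta>"
      using hard_fun_gap[of \<kappa> \<rho> T] \<kappa> \<rho> gap by (intro exI[of _ "- (\<kappa> * \<rho> * real T)"]) force
    moreover have "stochastic_gradients T n (hard_grad T \<kappa> \<rho>) \<sigma>sq (coin p) (\<lambda>_ _ _. coin p) ?g"
      using \<kappa>(1) \<rho>(1) p var by (rule coin_grad_stochastic)
    moreover have "Ionescu_Tulcea (sample_kernel A (\<lambda>i. cum_power (v i)) ?g (\<lambda>_ _ _. coin p)) (\<lambda>_. coin p)"
      unfolding sample_kernel_const by (rule Ionescu_Tulcea_const[OF prob_space_coin])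
    ultimately show ?thesis
      by (intro exI[of _ "hard_fun T \<kappa> \<rho>"] exI[of _ "hard_grad T \<kappa> \<rho>"] exI[of _ "coin p"]
          exI[of _ "\<lambda>_ _ _. coin p"] exI[of _ ?g] conjI)
        (simp_all only: sample_law_const[OF prob_space_coin])
  qed
  show "let V = (\<lambda>i. cum_power (v i)) in \<exists>d\<ge>1. \<forall>A. zero_respecting d n A \<longrightarrow>
          (\<exists>(f :: vec \<Rightarrow> real) (f' :: vec \<Rightarrow> vec) (S :: real measure)
             (D :: vec \<Rightarrow> real \<Rightarrow> nat \<Rightarrow> real measure)
             (g :: nat \<Rightarrow> vec \<Rightarrow> real \<Rightarrow> real \<Rightarrow> vec).
             smooth_fun d L f f' \<and>
             (\<exists>fstar. (\<forall>x\<in>Rd d. f x \<ge> fstar) \<and> f vzero - fstar \<le> \<Delta>) \<and>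
             stochastic_gradients d n f' \<sigma>sq S D g \<and>
             Ionescu_Tulcea (sample_kernel A V g D) (\<lambda>_. S) \<and>
             (let t = lower_time n V (1/4096 * real_of_int (max \<lceil>\<sigma>sq / \<epsilon>\<rceil> 1)) (nat \<lfloor>1/12288 * L * \<Delta> / \<epsilon>\<rfloor>) / 2
              in (\<integral>\<omega>. (INF k \<in> {k. ereal (proto_time A V g \<omega> k) \<le> t}.
                         (vnorm d (f' (proto_point A V g \<omega> k)))\<^sup>2)
                   \<partial>sample_law A V g S D) > \<epsilon>))"
    unfolding Let_def m_def[symmetric] K_def[symmetric]
    using T(3) main by (intro exI[of _ T] conjI allI impI)
qed auto

end
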